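(* Let $G$ be a finite supersoluble group that is a split extension over a nilpotent subgroup $N$ (that is, $N$ is a nilpotent normal subgroup of $G$ that has a complement in $G$). Suppose that for each prime $p$ there is a Sylow $p$-subgroup $S$ of $G$ such that any two complements of $S\cap N$ in $S$ are conjugate in $G$. Then any two complements of $N$ in $G$ are conjugate in $G$.
   Context: For a group $X$ and a normal subgroup $M$ of $X$, a complement of $M$ in $X$ is a subgroup $K\leq X$ with $X=MK$ and $M\cap K=1$. A finite group is supersoluble if it has a normal series (all terms normal in the whole group) with cyclic factors. *)

theory Defs
  imports "HOL-Algebra.Sylow" "HOL-Algebra.Elementary_Groups"
begin

definition normal_series :: "('a, 'b) monoid_scheme \<Rightarrow> (nat \<Rightarrow> 'a set) \<Rightarrow> nat \<Rightarrow> bool"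
  where "normal_series G H n \<longleftrightarrow>
    H 0 = {\<one>\<^bsub>G\<^esub>} \<and> H n = carrier G \<and>
    (\<forall>i\<le>n. H i \<lhd> G) \<and> (\<forall>i<n. H i \<subseteq> H (Suc i))"

definition supersoluble :: "('a, 'b) monoid_scheme \<Rightarrow> bool"
  where "supersoluble G \<longleftrightarrow>
    (\<exists>H n. normal_series G H n \<and>
      (\<forall>i<n. cyclic_group (G\<lparr>carrier := H (Suc i)\<rparr> Mod H i)))"

definition group_center :: "('a, 'b) monoid_scheme \<Rightarrow> 'a set"
  where "group_center G =
    {z \<in> carrier G. \<forall>g\<in>carrier G. z \<otimes>\<^bsub>G\<^esub> g = g \<otimes>\<^bsub>G\<^esub> z}"

definition nilpotent_group :: "('a, 'b) monoid_scheme \<Rightarrow> bool"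
  where "nilpotent_group G \<longleftrightarrow>
    (\<exists>H n. normal_series G H n \<and>
      (\<forall>i<n. carrier (G\<lparr>carrier := H (Suc i)\<rparr> Mod H i) \<subseteq> group_center (G Mod H i)))"

text \<open>Used only when \<open>M\<close> is a normal subgroup of the group \<open>G\<close>.\<close>

definition complement :: "('a, 'b) monoid_scheme \<Rightarrow> 'a set \<Rightarrow> 'a set \<Rightarrow> bool"
  where "complement G M K \<longleftrightarrow>
    subgroup K G \<and> carrier G = M <#>\<^bsub>G\<^esub> K \<and> M \<inter> K = {\<one>\<^bsub>G\<^esub>}"

definition conjugate_in :: "('a, 'b) monoid_scheme \<Rightarrow> 'a set \<Rightarrow> 'a set \<Rightarrow> bool"
  where "conjugate_in G K L \<longleftrightarrow>
    (\<exists>g\<in>carrier G. L = (g <#\<^bsub>G\<^esub> K) #>\<^bsub>G\<^esub> (inv\<^bsub>G\<^esub> g))"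

text \<open>For finite \<open>G\<close> and prime \<open>p\<close>; the trivial subgroup qualifies when \<open>p\<close> does not
  divide the order of \<open>G\<close>.\<close>

definition sylow_subgroup :: "('a, 'b) monoid_scheme \<Rightarrow> nat \<Rightarrow> 'a set \<Rightarrow> bool"
  where "sylow_subgroup G p S \<longleftrightarrow>
    subgroup S G \<and> card S = p ^ multiplicity p (order G)"

end

theory Submission
  imports Defs "HOL-Algebra.Group_Action" "HOL-Algebra.Multiplicative_Group" "HOL-Number_Theory.Cong"
begin

text \<open>Let \<open>K\<close> and \<open>L\<close> be complements of \<open>N\<close>. Sending \<open>k \<in> K\<close> to the element of \<open>L\<close> in the coset
\<open>N k\<close> is a homomorphism \<open>s\<close> from \<open>K\<close> to \<open>G\<close> with \<open>s k k\<^sup>-\<^sup>1 \<in> N\<close>, and \<open>L\<close> is a conjugate of \<open>K\<close> as soon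
as \<open>s\<close> is conjugation by some \<open>b \<in> N\<close>. Here \<open>k \<mapsto> s k k\<^sup>-\<^sup>1\<close> is a cocycle with values in \<open>N\<close>, and
the claim is that it is a coboundary; working with the homomorphism \<open>s\<close> turns the nonabelian
cocycle identities into plain multiplicativity.

The hypothesis on Sylow subgroups makes \<open>s\<close> locally trivial. A Sylow \<open>p\<close>-subgroup of \<open>K\<close>
can be moved into \<open>S\<close>, where counting shows that it complements \<open>S \<inter> N\<close>; the same holds
for \<open>L\<close>, so Sylow \<open>p\<close>-subgroups of \<open>K\<close> and of \<open>L\<close> are conjugate in \<open>G = N K\<close>. Hence
on some Sylow \<open>p\<close>-subgroup \<open>Q\<close> of \<open>K\<close> the map \<open>s\<close> is conjugation by an element of \<open>N\<close>
(\<open>sylow_conjugate_of_complements\<close>). Since \<open>N\<close> is nilpotent, for each prime \<open>p\<close> the projection of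
\<open>N\<close> to its Sylow \<open>p\<close>-subgroup is a power map, so it is compatible with conjugation and
turns \<open>s\<close> into a homomorphism that differs from the inclusion only by the \<open>p\<close>-group \<open>P\<close>. The
primes can thus be treated one after another (\<open>hom_conjugate_over_nilpotent\<close>).

Supersolubility is what makes local triviality at \<open>p\<close> sufficient for a nonabelian \<open>P\<close>
(\<open>hom_conjugate_over_p_group\<close>). Automorphisms of a cyclic group commute, so \<open>G\<close> is abelian modulo
the subgroup \<open>V\<close> of elements that act trivially on every factor of the series, and elements of \<open>V\<close>
induce automorphisms of \<open>p\<close>-power order on \<open>P\<close>. Consequently the elements of \<open>K\<close> whose \<open>|Q|\<close>-th
power lies in \<open>V\<close> form a normal subgroup \<open>W\<close> of \<open>K\<close> that contains \<open>Q\<close> and whose elements of order prime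
to \<open>p\<close> centralize \<open>P\<close>. On such elements \<open>s\<close> is the identity, because there the order of \<open>s k k\<^sup>-\<^sup>1\<close>
divides both a power of \<open>p\<close> and a number prime to \<open>p\<close>; after a conjugation \<open>s\<close> is the identity on \<open>Q\<close>
too, and so on all of \<open>W\<close>. Normality of \<open>W\<close> then forces \<open>s k k\<^sup>-\<^sup>1\<close> to centralize \<open>W\<close>, and since \<open>p\<close>
does not divide the index of \<open>W\<close> in \<open>K\<close>, averaging over \<open>K/W\<close>, one abelian factor of the series at a
time, exhibits \<open>s\<close> as a conjugation.\<close>

section \<open>Powers, commutators and products of subgroups\<close>

context group
begin

lemma inv_mult_cancel:
  assumes "x \<in> carrier G" "y \<in> carrier G"
  shows "inv x \<otimes> (x \<otimes> y) = y" and "x \<otimes> (inv x \<otimes> y) = y"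
  using assms by (simp_all flip: m_assoc)

lemmas word_simps = m_assoc inv_mult_group inv_mult_cancel

lemma pow_conj:
  assumes "g \<in> carrier G" "x \<in> carrier G"
  shows "(g \<otimes> x \<otimes> inv g) [^] (k::nat) = g \<otimes> x [^] k \<otimes> inv g"
  by (induction k) (use assms in \<open>simp_all add: word_simps\<close>)

lemma eq_one_if_coprime_powers:
  assumes "z \<in> carrier G" "z [^] (m::nat) = \<one>" "z [^] (n::nat) = \<one>" "coprime m n"
  shows "z = \<one>"
proof -
  have "ord z dvd m" "ord z dvd n" using assms pow_eq_id by auto
  with assms(4) have "ord z = 1" by (metis coprime_common_divisor_nat)
  then show ?thesis using ord_eq_1 assms(1) by simp
qed

text \<open>If moving \<open>b\<close> past \<open>a\<close> costs a factor \<open>z\<close> that commutes with \<open>a\<close>, then moving it past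
\<open>k\<close> copies of \<open>a\<close> costs \<open>k\<close> such factors.\<close>

lemma central_commutator_pow_eq:
  assumes c: "a \<in> carrier G" "b \<in> carrier G" "z \<in> carrier G"
    and "a \<otimes> b = z \<otimes> (b \<otimes> a)" and za: "z \<otimes> a = a \<otimes> z"
  shows "a [^] k \<otimes> b = z [^] k \<otimes> (b \<otimes> a [^] (k::nat))"
proof (induction k)
    case (Suc k)
    have "a [^] Suc k \<otimes> b = a [^] k \<otimes> (a \<otimes> b)" using c by (simp add: m_assoc)
    also have "\<dots> = a [^] k \<otimes> z \<otimes> (b \<otimes> a)" using c assms(4) by (simp add: m_assoc)
    also have "a [^] k \<otimes> z = z \<otimes> a [^] k" using group_commutes_pow[OF za[symmetric]] c by simp
    also have "z \<otimes> a [^] k \<otimes> (b \<otimes> a) = z \<otimes> (a [^] k \<otimes> b) \<otimes> a" using c by (simp add: m_assoc)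
    also have "\<dots> = z [^] Suc k \<otimes> (b \<otimes> a [^] Suc k)"
      using c nat_pow_Suc2[of z k] by (simp add: Suc.IH m_assoc del: nat_pow_Suc)
    finally show ?case .
qed (use c in auto)

lemma central_commutator_pow:
  assumes c: "a \<in> carrier G" "b \<in> carrier G" "z \<in> carrier G"
    and "a \<otimes> b = z \<otimes> (b \<otimes> a)" "z \<otimes> a = a \<otimes> z" "a [^] (m::nat) = \<one>"
  shows "z [^] m = \<one>"
proof -
  have "z [^] m \<otimes> b = b" using central_commutator_pow_eq[OF assms(1-5), of m] assms by simp
  then show ?thesis using c by (metis nat_pow_closed one_closed right_cancel l_one)
qed

text \<open>The order of a central commutator divides the orders of both of its entries.\<close>

lemma central_commutator_coprime:
  assumes c: "a \<in> carrier G" "b \<in> carrier G"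
    and z: "a \<otimes> b \<otimes> inv a \<otimes> inv b \<in> group_center G"
    and "a [^] (m::nat) = \<one>" "b [^] (n::nat) = \<one>" "coprime m n"
  shows "a \<otimes> b \<otimes> inv a \<otimes> inv b = \<one>"
proof -
  define z where "z = a \<otimes> b \<otimes> inv a \<otimes> inv b"
  have zc: "z \<in> carrier G" and za: "z \<otimes> a = a \<otimes> z" and zb: "z \<otimes> b = b \<otimes> z"
    using z c by (auto simp: z_def group_center_def)
  have ab: "a \<otimes> b = z \<otimes> (b \<otimes> a)" using c by (simp add: z_def word_simps)
  have ba: "b \<otimes> a = inv z \<otimes> (a \<otimes> b)" using c zc by (simp add: ab inv_mult_cancel)
  have "inv z \<otimes> b = b \<otimes> inv z" using zb zc c by (metis inv_closed inv_solve_left inv_solve_right m_assoc m_closed)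
  then have "inv z [^] n = \<one>" using central_commutator_pow[OF c(2,1) _ ba] zc assms by auto
  then have "z [^] n = \<one>" using zc by (metis nat_pow_inv inv_eq_1_iff nat_pow_closed)
  moreover have "z [^] m = \<one>" using central_commutator_pow[OF c zc ab za] assms by auto
  ultimately show ?thesis using eq_one_if_coprime_powers zc assms(6) unfolding z_def by blast
qed

lemma normal_coset_hom:
  assumes "H \<lhd> G"
  shows "group_hom G (G Mod H) (\<lambda>x. H #> x)"
  using assms normal.r_coset_hom_Mod normal.factorgroup_is_group
  by (metis group_hom.intro group_hom_axioms.intro is_group)

lemma coset_eq_one_iff:
  assumes "H \<lhd> G" "x \<in> carrier G"
  shows "H #> x = \<one>\<^bsub>G Mod H\<^esub> \<longleftrightarrow> x \<in> H"
  using assms normal_imp_subgroup coset_join1 coset_join2 subgroup.subset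
  by (metis one_FactGroup)

text \<open>The commutator of the two elements descends the central series: once it lies in one term, it is
central modulo the next, and there it vanishes because its order divides two coprime numbers.\<close>

lemma nilpotent_coprime_commute:
  assumes "nilpotent_group G"
    and c: "a \<in> carrier G" "b \<in> carrier G"
    and "a [^] (m::nat) = \<one>" "b [^] (n::nat) = \<one>" "coprime m n"
  shows "a \<otimes> b = b \<otimes> a"
proof -
  obtain H l where ns: "normal_series G H l"
    and cen: "\<And>i. i < l \<Longrightarrow> carrier (G\<lparr>carrier := H (Suc i)\<rparr> Mod H i) \<subseteq> group_center (G Mod H i)"
    using assms(1) unfolding nilpotent_group_def by blast
  define d where "d = a \<otimes> b \<otimes> inv a \<otimes> inv b"
  have dc: "d \<in> carrier G" using c by (simp add: d_def)
  have "d \<in> H (l - j)" if "j \<le> l" for j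
    using that
  proof (induction j)
    case 0
    then show ?case using ns dc by (simp add: normal_series_def)
  next
    case (Suc j)
    define i where "i = l - Suc j"
    have i: "i < l" "Suc i = l - j" using Suc.prems by (auto simp: i_def)
    have Hi: "H i \<lhd> G" using ns i by (simp add: normal_series_def)
    interpret q: group_hom G "G Mod H i" "\<lambda>x. H i #> x" by (rule normal_coset_hom[OF Hi])
    have "H i #> d \<in> carrier (G\<lparr>carrier := H (Suc i)\<rparr> Mod H i)"
      using Suc i by (auto simp: carrier_FactGroup)
    then have z: "H i #> d \<in> group_center (G Mod H i)" using cen i by blast
    have d: "H i #> d = (H i #> a) \<otimes>\<^bsub>G Mod H i\<^esub> (H i #> b) \<otimes>\<^bsub>G Mod H i\<^esub> inv\<^bsub>G Mod H i\<^esub> (H i #> a) \<otimes>\<^bsub>G Mod H i\<^esub> inv\<^bsub>G Mod H i\<^esub> (H i #> b)"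
      using c by (simp add: d_def del: mult_FactGroup)
    have "H i #> d = \<one>\<^bsub>G Mod H i\<^esub>"
      unfolding d
    proof (rule q.H.central_commutator_coprime)
      show "coprime m n" by fact
    qed (use c assms(4,5) z d q.hom_one in \<open>auto simp flip: q.hom_nat_pow simp del: mult_FactGroup one_FactGroup\<close>)
    then show ?case using coset_eq_one_iff[OF Hi dc] by (simp add: i_def)
  qed
  from this[of l] have "d = \<one>" using ns by (simp add: normal_series_def)
  then show ?thesis using c unfolding d_def by (metis inv_equality inv_inv inv_closed inv_mult_group m_closed m_assoc)
qed

lemma card_set_mult:
  assumes A: "subgroup A G" and B: "subgroup B G" and AB: "A \<inter> B = {\<one>}"
  shows "card (A <#> B) = card A * card B"
proof -
  interpret group_disjoint_sum G A B
    using A B by (simp add: group_disjoint_sum_def)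
  have "A <#> B = (\<lambda>(x,y). x \<otimes> y) ` (A \<times> B)" by (auto simp: set_mult_def)
  moreover have "inj_on (\<lambda>(x,y). x \<otimes> y) (A \<times> B)"
    using cancel AB by (auto simp: inj_on_def)
  ultimately show ?thesis by (simp add: card_image card_cartesian_product)
qed

lemma subgroup_pow_card:
  assumes "subgroup A G" "x \<in> A"
  shows "x [^] card A = \<one>"
proof -
  interpret A: group "G\<lparr>carrier := A\<rparr>" using assms(1) by (rule subgroup.subgroup_is_group) auto
  show ?thesis
    using A.pow_order_eq_1[of x] assms(2) nat_pow_consistent[of x "card A" A] by (simp add: order_def)
qed

lemma subgroup_card_dvd:
  assumes "subgroup A G" "subgroup B G" "A \<subseteq> B"
  shows "card A dvd card B"
proof -
  interpret B: group "G\<lparr>carrier := B\<rparr>" using assms(2) by (rule subgroup.subgroup_is_group) auto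
  have "card (rcosets\<^bsub>G\<lparr>carrier := B\<rparr>\<^esub> A) * card A = card B"
    using B.lagrange[OF subgroup_incl[OF assms]] by (simp add: order_def)
  then show ?thesis by (metis dvd_triv_right)
qed

lemma coprime_cards_Int:
  assumes "subgroup A G" "subgroup B G" "coprime (card A) (card B)"
  shows "A \<inter> B = {\<one>}"
proof (intro equalityI subsetI)
  fix x assume "x \<in> A \<inter> B"
  then show "x \<in> {\<one>}"
    using eq_one_if_coprime_powers[OF _ subgroup_pow_card subgroup_pow_card assms(3), of x] assms
    by (simp add: subgroup.mem_carrier)
qed (use assms subgroup.one_closed in auto)

lemma commuting_set_mult_subgroup:
  assumes A: "subgroup A G" and B: "subgroup B G"
    and "\<And>a b. a \<in> A \<Longrightarrow> b \<in> B \<Longrightarrow> a \<otimes> b = b \<otimes> a"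
  shows "subgroup (A <#> B) G"
proof (rule subgroupI)
  show "A <#> B \<subseteq> carrier G" using A B by (simp add: set_mult_closed subgroup.subset)
  show "A <#> B \<noteq> {}" using subgroup.one_closed[OF A] subgroup.one_closed[OF B] unfolding set_mult_def by blast
next
  fix x y assume "x \<in> A <#> B" "y \<in> A <#> B"
  then obtain a b a' b' where x: "x = a \<otimes> b" and y: "y = a' \<otimes> b'" and m: "a \<in> A" "b \<in> B" "a' \<in> A" "b' \<in> B"
    by (auto simp: set_mult_def)
  have c: "a \<in> carrier G" "b \<in> carrier G" "a' \<in> carrier G" "b' \<in> carrier G"
    using m A B subgroup.mem_carrier by metis+
  have "x \<otimes> y = a \<otimes> (b \<otimes> a') \<otimes> b'" using c by (simp add: x y m_assoc)
  also have "b \<otimes> a' = a' \<otimes> b" using assms(3)[of a' b] m by simp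
  finally have "x \<otimes> y = (a \<otimes> a') \<otimes> (b \<otimes> b')" using c by (simp add: m_assoc)
  then show "x \<otimes> y \<in> A <#> B" using subgroup.m_closed[OF A m(1,3)] subgroup.m_closed[OF B m(2,4)] unfolding set_mult_def by blast
  have "x = b \<otimes> a" using assms(3)[OF m(1,2)] x by simp
  then have "inv x = inv a \<otimes> inv b" using c by (simp add: inv_mult_group)
  then show "inv x \<in> A <#> B" using subgroup.m_inv_closed[OF A m(1)] subgroup.m_inv_closed[OF B m(2)] unfolding set_mult_def by blast
qed

section \<open>Primary projections of a finite nilpotent group\<close>

lemma pow_mod_exponent:
  assumes "x \<in> carrier G" "x [^] (m::nat) = \<one>"
  shows "x [^] (k::nat) = x [^] (k mod m)"
proof -
  have "x [^] k = x [^] (m * (k div m) + k mod m)" by simp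
  also have "\<dots> = (x [^] m) [^] (k div m) \<otimes> x [^] (k mod m)"
    using assms(1) by (simp only: nat_pow_mult nat_pow_pow)
  finally show ?thesis using assms by simp
qed

lemma pow_cong:
  assumes "x \<in> carrier G" "x [^] (m::nat) = \<one>" "[k = l] (mod m)"
  shows "x [^] k = x [^] l"
  using assms pow_mod_exponent[of x m] unfolding cong_def by metis

lemma sylow_subgroup_of_subgroup:
  assumes "finite (carrier G)" "subgroup K G" "Factorial_Ring.prime (p::nat)"
  shows "\<exists>Q. subgroup Q G \<and> Q \<subseteq> K \<and> card Q = p ^ multiplicity p (card K)"
proof -
  interpret K: group "G\<lparr>carrier := K\<rparr>" using assms(2) by (rule subgroup.subgroup_is_group) auto
  have fin: "finite K" using assms finite_subset subgroup.subset by blast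
  have "p ^ multiplicity p (card K) dvd card K" by (rule multiplicity_dvd)
  then obtain m where "card K = p ^ multiplicity p (card K) * m" ..
  then obtain Q where Q: "subgroup Q (G\<lparr>carrier := K\<rparr>)" "card Q = p ^ multiplicity p (card K)"
    using sylow_thm[OF assms(3) K.is_group, of "multiplicity p (card K)" m] fin by (auto simp: order_def)
  then show ?thesis
    using incl_subgroup[OF assms(2) Q(1)] subgroup.subset[OF Q(1)] by auto
qed

lemma commute_if_coprime_cards:
  assumes "nilpotent_group G" "subgroup A G" "subgroup B G" "coprime (card A) (card B)"
    and "a \<in> A" "b \<in> B"
  shows "a \<otimes> b = b \<otimes> a"
  using nilpotent_coprime_commute[OF assms(1) subgroup.mem_carrier[OF assms(2,5)]
      subgroup.mem_carrier[OF assms(3,6)] subgroup_pow_card[OF assms(2,5)]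
      subgroup_pow_card[OF assms(3,6)] assms(4)] .

text \<open>Sylow subgroups for different primes commute elementwise, so their products are subgroups.\<close>

lemma nilpotent_hall_subgroup:
  assumes nil: "nilpotent_group G" and fin: "finite (carrier G)"
    and "finite F" "\<And>q. q \<in> F \<Longrightarrow> Factorial_Ring.prime (q::nat)"
  shows "\<exists>B. subgroup B G \<and> card B = (\<Prod>q\<in>F. q ^ multiplicity q (order G))"
  using assms(3,4)
proof (induction F)
  case empty
  show ?case by (rule exI[of _ "{\<one>}"]) (simp add: triv_subgroup)
next
  case (insert p F)
  have "\<exists>B. subgroup B G \<and> card B = (\<Prod>q\<in>F. q ^ multiplicity q (order G))"
    by (rule insert.IH) (use insert.prems in blast)
  then obtain B where B: "subgroup B G" "card B = (\<Prod>q\<in>F. q ^ multiplicity q (order G))" by (elim exE conjE)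
  obtain A where A: "subgroup A G" "card A = p ^ multiplicity p (order G)"
    using sylow_subgroup_of_subgroup[OF fin subgroup_self insert.prems[OF insertI1]]
    unfolding order_def by blast
  have cop: "coprime (card A) (card B)"
    unfolding A(2) B(2)
  proof (rule prod_coprime_right)
    fix q assume "q \<in> F"
    then have "coprime p q" using insert.hyps insert.prems[of p] insert.prems[of q] primes_coprime[of p q] by auto
    then show "coprime (p ^ multiplicity p (order G)) (q ^ multiplicity q (order G))" by simp
  qed
  have "subgroup (A <#> B) G"
    using commuting_set_mult_subgroup[OF A(1) B(1)] commute_if_coprime_cards[OF nil A(1) B(1) cop] by blast
  moreover have "card (A <#> B) = card A * card B"
    using card_set_mult[OF A(1) B(1) coprime_cards_Int[OF A(1) B(1) cop]] .
  moreover have "card A * card B = (\<Prod>q\<in>insert p F. q ^ multiplicity q (order G))"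
    using A B insert.hyps by simp
  ultimately show ?case by (intro exI[of _ "A <#> B"]) simp
qed

text \<open>The group is an elementwise commuting product \<open>A B\<close> of a Sylow \<open>p\<close>-subgroup \<open>A\<close> and a Hall
subgroup \<open>B\<close> of order prime to \<open>p\<close>. An exponent that is \<open>1\<close> modulo \<open>|A|\<close> and \<open>0\<close> modulo \<open>|B|\<close>
therefore sends \<open>u v\<close> to \<open>u\<close>. Expressing the projection as a power makes it commute with
every automorphism, in particular with conjugation inside a larger group.\<close>

lemma nilpotent_primary_projection:
  assumes nil: "nilpotent_group G" and fin: "finite (carrier G)" and p: "Factorial_Ring.prime (p::nat)"
  obtains e :: nat where
    "\<And>x y. x \<in> carrier G \<Longrightarrow> y \<in> carrier G \<Longrightarrow> (x \<otimes> y) [^] e = x [^] e \<otimes> y [^] e"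
    "\<And>x. x \<in> carrier G \<Longrightarrow> (x [^] e) [^] (p ^ multiplicity p (order G)) = \<one>"
    "\<And>x k. x \<in> carrier G \<Longrightarrow> x [^] (p ^ k) = \<one> \<Longrightarrow> x [^] e = x"
    "\<And>x k. x \<in> carrier G \<Longrightarrow> x [^] k = \<one> \<Longrightarrow> \<not> p dvd k \<Longrightarrow> x [^] e = \<one>"
    "\<And>x. x \<in> carrier G \<Longrightarrow> p dvd ord x \<Longrightarrow> x [^] e \<noteq> \<one>"
    "card {x \<in> carrier G. x [^] (p ^ multiplicity p (order G)) = \<one>} = p ^ multiplicity p (order G)"
proof -
  define a where "a = multiplicity p (order G)"
  define r where "r = order G div p ^ a"
  have oG: "order G > 0" using fin order_gt_0_iff_finite by simp
  have or: "order G = p ^ a * r" unfolding r_def a_def by (rule dvd_mult_div_cancel[symmetric, OF multiplicity_dvd])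
  have pr: "\<not> p dvd r"
    unfolding r_def a_def using multiplicity_decompose[of "order G" p] oG not_prime_unit[of p] p by blast
  then have cop: "coprime (p ^ a) r" using p prime_imp_coprime by auto
  obtain A where A: "subgroup A G" "card A = p ^ a"
    using sylow_subgroup_of_subgroup[OF fin subgroup_self p] unfolding order_def a_def by blast
  obtain B where B: "subgroup B G" "card B = r"
  proof -
    have "r = (\<Prod>q\<in>prime_factors (order G) - {p}. q ^ multiplicity q (order G))"
    proof (cases "p \<in> prime_factors (order G)")
      case True
      have "order G = (\<Prod>q\<in>prime_factors (order G). q ^ multiplicity q (order G))"
        using oG prime_factorization_nat by blast
      also have "\<dots> = p ^ a * (\<Prod>q\<in>prime_factors (order G) - {p}. q ^ multiplicity q (order G))"
        unfolding a_def by (rule prod.remove) (use True in auto)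
      finally have "p ^ a * r = \<dots>" using or by simp
      then show ?thesis using p by (simp add: prime_gt_0_nat)
    next
      case False
      then have "a = 0" using oG p unfolding a_def by (metis not_dvd_imp_multiplicity_0 in_prime_factors_iff neq0_conv)
      then show ?thesis using False or oG prime_factorization_nat[of "order G"] by simp
    qed
    then show ?thesis
      using that nilpotent_hall_subgroup[OF nil fin, of "prime_factors (order G) - {p}"] by auto
  qed
  have cAB: "coprime (card A) (card B)" using A B cop by simp
  have com: "x \<otimes> y = y \<otimes> x" if "x \<in> A" "y \<in> B" for x y
    using commute_if_coprime_cards[OF nil A(1) B(1) cAB that] .
  have AB: "\<exists>u\<in>A. \<exists>v\<in>B. x = u \<otimes> v" if "x \<in> carrier G" for x
  proof -
    have "card (A <#> B) = order G"
      using card_set_mult[OF A(1) B(1) coprime_cards_Int[OF A(1) B(1) cAB]] A B or by simp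
    then have "A <#> B = carrier G"
      using fin A B by (metis card_subset_eq order_def set_mult_closed subgroup.subset)
    then show ?thesis using that unfolding set_mult_def by fast
  qed
  obtain e where e: "[e = 1] (mod p ^ a)" "[e = 0] (mod r)"
    using binary_chinese_remainder_nat[OF cop] by blast
  have re: "r dvd e" using e(2) by (simp add: cong_0_iff)
  note Ac = subgroup.mem_carrier[OF A(1)] and Bc = subgroup.mem_carrier[OF B(1)]
  have Ae: "u [^] e = u" if "u \<in> A" for u
    using pow_cong[OF _ _ e(1), of u] subgroup_pow_card[OF A(1)] A(2) Ac that by simp
  have Be: "v [^] e = \<one>" if "v \<in> B" for v
    using pow_cong[OF _ _ e(2), of v] subgroup_pow_card[OF B(1)] B(2) Bc that by simp
  have ABe: "(u \<otimes> v) [^] e = u" if "u \<in> A" "v \<in> B" for u v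
    using that pow_mult_distrib[OF com] Ae Be Ac Bc by simp
  have e2: "(x [^] e) [^] (p ^ a) = \<one>" if "x \<in> carrier G" for x
  proof -
    have "order G dvd e * p ^ a" unfolding or using re by (simp add: mult.commute mult_dvd_mono)
    then have "ord x dvd e * p ^ a" using ord_dvd_group_order[OF that] dvd_trans by blast
    then show ?thesis using that by (simp add: nat_pow_pow pow_eq_id)
  qed
  have e3: "x [^] e = x" if x: "x \<in> carrier G" "x [^] (p ^ k) = \<one>" for x k
  proof -
    have "coprime (p ^ k) r" using prime_imp_coprime[OF p pr] by simp
    moreover have "ord x dvd p ^ k" using x pow_eq_id by blast
    ultimately have "coprime (ord x) r" using coprime_divisors dvd_refl by blast
    moreover have "ord x dvd p ^ a * r" using ord_dvd_group_order[OF x(1)] or by simp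
    ultimately have "ord x dvd p ^ a" using coprime_dvd_mult_left_iff by blast
    then have "x [^] (p ^ a) = \<one>" using x(1) pow_eq_id by blast
    then show ?thesis using pow_cong[OF x(1) _ e(1)] x by simp
  qed
  have e4: "x [^] e = \<one>" if x: "x \<in> carrier G" "x [^] k = \<one>" "\<not> p dvd k" for x k
  proof -
    have "coprime k (p ^ a)" using prime_imp_coprime[OF p x(3)] by (simp add: coprime_commute)
    moreover have "ord x dvd k" using x pow_eq_id by blast
    ultimately have "coprime (ord x) (p ^ a)" using coprime_divisors dvd_refl by blast
    moreover have "ord x dvd p ^ a * r" using ord_dvd_group_order[OF x(1)] or by simp
    ultimately have "ord x dvd r" using coprime_dvd_mult_right_iff by blast
    then have "ord x dvd e" using re by (rule dvd_trans)
    then show ?thesis using x(1) pow_eq_id by blast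
  qed
  have e5: "x [^] e \<noteq> \<one>" if x: "x \<in> carrier G" "p dvd ord x" for x
  proof
    assume "x [^] e = \<one>"
    then have "ord x dvd e" using x(1) pow_eq_id by blast
    then have "p dvd e" using x(2) dvd_trans by blast
    have "p dvd p ^ a * r" using dvd_trans[OF x(2) ord_dvd_group_order[OF x(1)]] or by simp
    then have "p dvd p ^ a" using pr p prime_dvd_mult_iff by blast
    then have "[e = 1] (mod p)" using e(1) cong_dvd_modulus_nat by blast
    with \<open>p dvd e\<close> have "p dvd 1" by (simp add: cong_dvd_iff)
    then show False using p not_prime_unit by blast
  qed
  have e1: "(x \<otimes> y) [^] e = x [^] e \<otimes> y [^] e" if xy: "x \<in> carrier G" "y \<in> carrier G" for x y
  proof -
    obtain u v u' v' where uv: "u \<in> A" "v \<in> B" "u' \<in> A" "v' \<in> B" and x: "x = u \<otimes> v" and y: "y = u' \<otimes> v'"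
      using AB xy by metis
    note c = Ac[OF uv(1)] Bc[OF uv(2)] Ac[OF uv(3)] Bc[OF uv(4)]
    have "x \<otimes> y = u \<otimes> (v \<otimes> u') \<otimes> v'" using c by (simp add: x y m_assoc)
    also have "v \<otimes> u' = u' \<otimes> v" using com[of u' v] uv by simp
    finally have "x \<otimes> y = (u \<otimes> u') \<otimes> (v \<otimes> v')" using c by (simp add: m_assoc)
    then have "(x \<otimes> y) [^] e = u \<otimes> u'"
      using ABe uv subgroup.m_closed[OF A(1)] subgroup.m_closed[OF B(1)] by simp
    then show ?thesis using ABe uv x y by simp
  qed
  have "{x \<in> carrier G. x [^] (p ^ a) = \<one>} = A"
  proof (intro equalityI subsetI)
    fix x assume "x \<in> {x \<in> carrier G. x [^] (p ^ a) = \<one>}"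
    then have x: "x \<in> carrier G" "x [^] e = x" using e3 by auto
    then obtain u v where "u \<in> A" "v \<in> B" "x = u \<otimes> v" using AB by blast
    then show "x \<in> A" using ABe x by metis
  qed (use subgroup_pow_card[OF A(1)] A(2) Ac in auto)
  then show ?thesis using that[OF e1 e2[unfolded a_def] e3 e4 e5] A(2) by (simp add: a_def)
qed

end

section \<open>Sylow subgroups up to conjugacy\<close>

text \<open>Orbits have \<open>p\<close>-power length, and not all lengths can be divisible by \<open>p\<close>.\<close>

lemma (in group_action) p_group_fixed_point:
  assumes "finite E" "Factorial_Ring.prime (p::nat)" "order G = p ^ t" "\<not> p dvd card E"
  shows "\<exists>x\<in>E. \<forall>g\<in>carrier G. \<phi> g x = x"
proof -
  interpret group_hom G "BijGroup E" \<phi> by (rule group_hom)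
  have "card E = (\<Sum>orb\<in>orbits G E \<phi>. \<Sum>x\<in>orb. 1)"
    using disjoint_sum[OF assms(1), of "\<lambda>_. 1::nat"] unfolding card_eq_sum ..
  moreover have "p dvd (\<Sum>orb\<in>orbits G E \<phi>. \<Sum>x\<in>orb. 1)"
    if "\<And>orb. orb \<in> orbits G E \<phi> \<Longrightarrow> p dvd card orb"
    by (rule dvd_sum) (use that in simp)
  ultimately have "\<exists>orb\<in>orbits G E \<phi>. \<not> p dvd card orb" using assms(4) by metis
  then obtain x where x: "x \<in> E" "\<not> p dvd card (orbit G \<phi> x)" by (auto simp: orbits_def)
  have "card (orbit G \<phi> x) dvd p ^ t" using orbit_stabilizer_theorem[OF x(1)] assms(3) by (metis dvd_triv_left)
  then obtain i where "card (orbit G \<phi> x) = p ^ i" using assms(2) divides_primepow_nat by blast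
  with x(2) have "card (orbit G \<phi> x) = 1" by (cases i) auto
  then obtain y where "orbit G \<phi> x = {y}" by (rule card_1_singletonE)
  then have y: "orbit G \<phi> x = {x}" using orbit_refl[OF x(1)] by simp
  have "\<phi> g x = x" if "g \<in> carrier G" for g
  proof -
    have "\<phi> g x \<in> orbit G \<phi> x" using that by (auto simp: orbit_def)
    then show ?thesis using y by simp
  qed
  then show ?thesis using x(1) by blast
qed

context group
begin

lemma right_coset_action:
  assumes S: "subgroup S G" and T: "subgroup T G"
  shows "group_action (G\<lparr>carrier := T\<rparr>) (rcosets S) (\<lambda>t. \<lambda>C\<in>rcosets S. C #> inv t)"
proof -
  define \<phi> where "\<phi> = (\<lambda>t. \<lambda>C\<in>rcosets S. C #> inv t)"
  note Sc = subgroup.subset[OF S] and Tc = subgroup.mem_carrier[OF T]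
  have cl: "C #> g \<in> rcosets S" if "C \<in> rcosets S" "g \<in> carrier G" for C g
    using that Sc by (auto simp: RCOSETS_def coset_mult_assoc)
  have sub: "C \<subseteq> carrier G" if "C \<in> rcosets S" for C
    using that by (rule subgroup.rcosets_carrier[OF S is_group])
  have bij: "bij_betw (\<phi> t) (rcosets S) (rcosets S)" if "t \<in> T" for t
  proof (rule bij_betw_byWitness[where f' = "\<lambda>C. C #> t"])
    show "\<forall>C\<in>rcosets S. \<phi> t C #> t = C"
      using that Tc sub by (simp add: \<phi>_def coset_mult_assoc)
    show "\<forall>C\<in>rcosets S. \<phi> t (C #> t) = C"
      using that Tc sub cl by (simp add: \<phi>_def coset_mult_assoc)
  qed (use that Tc cl in \<open>auto simp: \<phi>_def\<close>)
  have "\<phi> \<in> hom (G\<lparr>carrier := T\<rparr>) (BijGroup (rcosets S))"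
  proof (rule homI)
    fix t assume "t \<in> carrier (G\<lparr>carrier := T\<rparr>)"
    then show "\<phi> t \<in> carrier (BijGroup (rcosets S))"
      using bij by (simp add: BijGroup_def Bij_def \<phi>_def)
  next
    fix t u assume tu: "t \<in> carrier (G\<lparr>carrier := T\<rparr>)" "u \<in> carrier (G\<lparr>carrier := T\<rparr>)"
    then have "\<phi> (t \<otimes> u) = compose (rcosets S) (\<phi> t) (\<phi> u)"
      using Tc sub cl by (auto simp: \<phi>_def compose_def coset_mult_assoc inv_mult_group fun_eq_iff)
    then show "\<phi> (t \<otimes>\<^bsub>G\<lparr>carrier := T\<rparr>\<^esub> u) = \<phi> t \<otimes>\<^bsub>BijGroup (rcosets S)\<^esub> \<phi> u"
      using tu bij by (simp add: BijGroup_def Bij_def) (simp add: \<phi>_def)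
  qed
  then show ?thesis
    unfolding group_action_def group_hom_def group_hom_axioms_def
    using group_BijGroup subgroup.subgroup_is_group[OF T is_group] by (simp add: \<phi>_def)
qed

text \<open>A coset \<open>S g\<close> fixed by right multiplication with \<open>T\<close> satisfies \<open>g T g\<^sup>-\<^sup>1 \<subseteq> S\<close>; one exists because
the number of cosets of \<open>S\<close> is prime to \<open>p\<close>.\<close>

lemma p_subgroup_conj_into:
  assumes fin: "finite (carrier G)" and p: "Factorial_Ring.prime (p::nat)"
    and S: "sylow_subgroup G p S" and T: "subgroup T G" "card T = p ^ t"
  shows "\<exists>g\<in>carrier G. \<forall>x\<in>T. g \<otimes> x \<otimes> inv g \<in> S"
proof -
  have S': "subgroup S G" "card S = p ^ multiplicity p (order G)" using S by (auto simp: sylow_subgroup_def)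
  interpret group_action "G\<lparr>carrier := T\<rparr>" "rcosets S" "\<lambda>t. \<lambda>C\<in>rcosets S. C #> inv t"
    using right_coset_action[OF S'(1) T(1)] .
  have oG: "order G > 0" using fin order_gt_0_iff_finite by simp
  have lag: "card (rcosets S) * p ^ multiplicity p (order G) = order G" using lagrange[OF S'(1)] S'(2) by simp
  have "\<not> p dvd card (rcosets S)"
  proof -
    have "card (rcosets S) = order G div p ^ multiplicity p (order G)"
      using lag p by (metis nonzero_mult_div_cancel_right not_prime_0 power_not_zero)
    then show ?thesis using multiplicity_decompose[of "order G" p] oG prime_gt_1_nat[OF p] by simp
  qed
  moreover have "finite (rcosets S)" using fin by (simp add: RCOSETS_def)
  ultimately obtain C where C: "C \<in> rcosets S" "\<And>t. t \<in> T \<Longrightarrow> C #> inv t = C"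
    using p_group_fixed_point[OF _ p, of t] T(2) by (auto simp: order_def)
  then obtain g where g: "g \<in> carrier G" "C = S #> g" by (auto simp: RCOSETS_def)
  have "g \<otimes> x \<otimes> inv g \<in> S" if "x \<in> T" for x
  proof -
    have x: "x \<in> carrier G" using that T subgroup.mem_carrier by metis
    have "C #> x = C" using C(2)[of "inv x"] that T x subgroup.m_inv_closed by fastforce
    then have "S #> (g \<otimes> x) = S #> g" using g x subgroup.subset[OF S'(1)] by (simp add: coset_mult_assoc)
    then have "g \<otimes> x \<in> S #> g" using rcos_self[of "g \<otimes> x" S] g x S' by simp
    then obtain s where s: "s \<in> S" "g \<otimes> x = s \<otimes> g" by (auto simp: r_coset_def)
    then have "g \<otimes> x \<otimes> inv g = s" using g x subgroup.mem_carrier[OF S'(1) s(1)] by (simp add: m_assoc)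
    then show ?thesis using s by simp
  qed
  then show ?thesis using g by blast
qed

lemma subgroup_eq_if_contains_sylows:
  assumes fin: "finite (carrier G)" and X: "subgroup X G" and Y: "subgroup Y G" "Y \<subseteq> X"
    and syl: "\<And>r. Factorial_Ring.prime (r::nat) \<Longrightarrow>
      \<exists>Q. subgroup Q G \<and> Q \<subseteq> Y \<and> card Q = r ^ multiplicity r (card X)"
  shows "Y = X"
proof (rule card_subset_eq)
  show finX: "finite X" using fin X subgroup.subset finite_subset by metis
  have pos: "card X > 0" "card Y > 0"
    using subgroup.finite_imp_card_positive[OF _ fin] X Y by auto
  have "card X dvd card Y"
  proof (rule multiplicity_le_imp_dvd)
    fix r :: nat assume r: "Factorial_Ring.prime r"
    then obtain Q where Q: "subgroup Q G" "Q \<subseteq> Y" "card Q = r ^ multiplicity r (card X)" using syl by blast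
    then have "r ^ multiplicity r (card X) dvd card Y" using subgroup_card_dvd[OF Q(1) Y(1)] by simp
    then show "multiplicity r (card X) \<le> multiplicity r (card Y)"
      using r pos(2) by (intro multiplicity_geI) (auto simp: not_prime_unit)
  qed (use pos in auto)
  then show "card Y = card X" using subgroup_card_dvd[OF Y(1) X Y(2)] dvd_antisym by blast
qed (use Y in auto)

section \<open>Averaging over cosets\<close>

text \<open>The index set \<open>\<Omega>\<close> stands for the cosets of a subgroup on which the cocycle \<open>c\<close> is trivial, so that \<open>c\<close>
induces the function \<open>f\<close> on them. The product of all values of \<open>f\<close> splits the \<open>|\<Omega>|\<close>-th power of \<open>c\<close>,
and \<open>u\<close> is an inverse of \<open>|\<Omega>|\<close> modulo the exponent of the values of \<open>c\<close>. Only the elements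
\<open>\<kappa> k\<close> enter as operators, which leaves \<open>k \<mapsto> \<kappa> k\<close> free to be reduction modulo a normal subgroup.\<close>

lemma averaging_coboundary:
  assumes E: "subgroup E G" and com: "\<And>x y. x \<in> E \<Longrightarrow> y \<in> E \<Longrightarrow> x \<otimes> y = y \<otimes> x"
    and \<kappa>: "\<And>k. k \<in> I \<Longrightarrow> \<kappa> k \<in> carrier G"
    and norm: "\<And>k e. k \<in> I \<Longrightarrow> e \<in> E \<Longrightarrow> \<kappa> k \<otimes> e \<otimes> inv (\<kappa> k) \<in> E"
    and \<Omega>: "finite \<Omega>" "\<And>k. k \<in> I \<Longrightarrow> bij_betw (act k) \<Omega> \<Omega>"
    and f: "\<And>\<omega>. \<omega> \<in> \<Omega> \<Longrightarrow> f \<omega> \<in> E" and c: "\<And>k. k \<in> I \<Longrightarrow> c k \<in> E"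
    and eq: "\<And>k \<omega>. k \<in> I \<Longrightarrow> \<omega> \<in> \<Omega> \<Longrightarrow> f (act k \<omega>) = c k \<otimes> (\<kappa> k \<otimes> f \<omega> \<otimes> inv (\<kappa> k))"
    and u: "\<And>k. k \<in> I \<Longrightarrow> c k [^] (card \<Omega> * u :: nat) = c k"
  shows "\<exists>b\<in>E. \<forall>k\<in>I. c k = b \<otimes> \<kappa> k \<otimes> inv b \<otimes> inv (\<kappa> k)"
proof -
  define A where "A = G\<lparr>carrier := E\<rparr>"
  have grpA: "group A" unfolding A_def using E by (rule subgroup.subgroup_is_group) auto
  interpret A: comm_group A
    by (rule group.group_comm_groupI[OF grpA]) (use com in \<open>simp add: A_def\<close>)
  have cA: "carrier A = E" and mA: "\<And>x y. x \<otimes>\<^bsub>A\<^esub> y = x \<otimes> y" and oA: "\<one>\<^bsub>A\<^esub> = \<one>"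
    and pA: "\<And>x (k::nat). x [^]\<^bsub>A\<^esub> k = x [^] k"
    by (auto simp: A_def simp flip: nat_pow_consistent)
  note Ec = subgroup.mem_carrier[OF E]
  have conj_prod: "finprod A (\<lambda>\<omega>. \<kappa> k \<otimes> f \<omega> \<otimes> inv (\<kappa> k)) F = \<kappa> k \<otimes> finprod A f F \<otimes> inv (\<kappa> k)"
    if k: "k \<in> I" and F: "F \<subseteq> \<Omega>" for k F
    using finite_subset[OF F \<Omega>(1)] F
  proof (induction F)
    case empty
    then show ?case using \<kappa>[OF k] by (simp add: oA)
  next
    case (insert \<omega> F)
    have fF: "f \<in> F \<rightarrow> carrier A" "f \<omega> \<in> carrier A" using insert.prems f by (auto simp: cA)
    then have P: "finprod A f F \<in> E" using A.finprod_closed by (simp add: cA)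
    have gF: "(\<lambda>\<omega>. \<kappa> k \<otimes> f \<omega> \<otimes> inv (\<kappa> k)) \<in> F \<rightarrow> carrier A" "\<kappa> k \<otimes> f \<omega> \<otimes> inv (\<kappa> k) \<in> carrier A"
      using insert.prems f norm[OF k] by (auto simp: cA)
    have "f \<omega> \<in> E" using fF cA by simp
    then show ?case
      using insert fF gF Ec P \<kappa>[OF k] by (simp add: mA word_simps)
  qed
  define B where "B = finprod A f \<Omega>"
  have fA: "f \<in> \<Omega> \<rightarrow> carrier A" using f by (auto simp: cA)
  have BE: "B \<in> E" unfolding B_def using A.finprod_closed[OF fA] by (simp add: cA)
  have key: "B = c k [^] card \<Omega> \<otimes> (\<kappa> k \<otimes> B \<otimes> inv (\<kappa> k))" if k: "k \<in> I" for k
  proof -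
    have im: "act k ` \<Omega> = \<Omega>" and inj: "inj_on (act k) \<Omega>"
      using \<Omega>(2)[OF k] by (auto simp: bij_betw_def)
    have "B = finprod A f (act k ` \<Omega>)" by (simp add: B_def im)
    also have "\<dots> = finprod A (\<lambda>\<omega>. f (act k \<omega>)) \<Omega>"
      using A.finprod_reindex[OF _ inj, of f] fA by (simp add: im)
    also have "\<dots> = finprod A (\<lambda>\<omega>. c k \<otimes>\<^bsub>A\<^esub> (\<kappa> k \<otimes> f \<omega> \<otimes> inv (\<kappa> k))) \<Omega>"
      by (rule A.finprod_cong') (use eq k c f norm subgroup.m_closed[OF E] in \<open>auto simp: mA cA\<close>)
    also have "\<dots> = finprod A (\<lambda>\<omega>. c k) \<Omega> \<otimes>\<^bsub>A\<^esub> finprod A (\<lambda>\<omega>. \<kappa> k \<otimes> f \<omega> \<otimes> inv (\<kappa> k)) \<Omega>"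
      by (rule A.finprod_multf) (use k c f norm in \<open>auto simp: cA\<close>)
    also have "\<dots> = c k [^] card \<Omega> \<otimes> (\<kappa> k \<otimes> B \<otimes> inv (\<kappa> k))"
      using A.finprod_const[of "c k" \<Omega>] c[OF k] conj_prod[OF k order_refl] by (simp add: mA pA cA B_def)
    finally show ?thesis .
  qed
  define b where "b = B [^] u"
  have powE: "x [^] (j::nat) \<in> E" if "x \<in> E" for x j
    using A.nat_pow_closed[of x j] that by (simp add: cA pA)
  have bE: "b \<in> E" unfolding b_def using powE BE .
  have "c k = b \<otimes> \<kappa> k \<otimes> inv b \<otimes> inv (\<kappa> k)" if k: "k \<in> I" for k
  proof -
    note cr = Ec[OF c[OF k]] \<kappa>[OF k] Ec[OF BE] Ec[OF bE]
    have "b = (c k [^] card \<Omega> \<otimes> (\<kappa> k \<otimes> B \<otimes> inv (\<kappa> k))) [^] u" unfolding b_def using key[OF k] by simp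
    also have "\<dots> = (c k [^] card \<Omega>) [^] u \<otimes> (\<kappa> k \<otimes> B \<otimes> inv (\<kappa> k)) [^] u"
      by (rule pow_mult_distrib) (use com powE c k norm BE cr in auto)
    also have "\<dots> = c k \<otimes> (\<kappa> k \<otimes> b \<otimes> inv (\<kappa> k))"
      using cr u[OF k] by (simp add: nat_pow_pow pow_conj b_def)
    finally have "c k = b \<otimes> inv (\<kappa> k \<otimes> b \<otimes> inv (\<kappa> k))"
      using cr by (metis inv_solve_right inv_closed m_closed)
    then show ?thesis using cr by (simp add: word_simps)
  qed
  then show ?thesis using bE by blast
qed

text \<open>The step for one abelian factor \<open>D / (D \<inter> B)\<close>. Because \<open>s\<close> is the identity on \<open>W\<close> and \<open>D\<close> centralizes
\<open>W\<close>, the element \<open>s k k\<^sup>-\<^sup>1\<close> depends only on the coset \<open>W k\<close>, and averaging over these cosets in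
\<open>G/B\<close> applies. The averaging element is found as a coset of \<open>B\<close> that has a representative in \<open>D\<close>.\<close>

lemma hom_conjugate_to_inclusion_mod:
  assumes fin: "finite (carrier G)"
    and K: "subgroup K G" and W: "subgroup W G" "W \<subseteq> K"
    and WK: "\<And>k w. k \<in> K \<Longrightarrow> w \<in> W \<Longrightarrow> k \<otimes> w \<otimes> inv k \<in> W"
    and D: "subgroup D G" and DK: "\<And>k d. k \<in> K \<Longrightarrow> d \<in> D \<Longrightarrow> k \<otimes> d \<otimes> inv k \<in> D"
    and DW: "\<And>d w. d \<in> D \<Longrightarrow> w \<in> W \<Longrightarrow> d \<otimes> w = w \<otimes> d"
    and B: "B \<lhd> G" and DB: "\<And>x y. x \<in> D \<Longrightarrow> y \<in> D \<Longrightarrow> x \<otimes> y \<otimes> inv x \<otimes> inv y \<in> B"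
    and M: "\<And>d. d \<in> D \<Longrightarrow> d [^] (M::nat) = \<one>"
    and ind: "coprime (card (rcosets\<^bsub>G\<lparr>carrier := K\<rparr>\<^esub> W)) M"
    and s: "s \<in> hom (G\<lparr>carrier := K\<rparr>) G" and sD: "\<And>k. k \<in> K \<Longrightarrow> s k \<otimes> inv k \<in> D"
    and sW: "\<And>w. w \<in> W \<Longrightarrow> s w = w"
  shows "\<exists>b\<in>D. \<forall>k\<in>K. inv b \<otimes> s k \<otimes> b \<otimes> inv k \<in> B"
proof -
  note Kc = subgroup.mem_carrier[OF K] and Wc = subgroup.mem_carrier[OF W(1)] and Dc = subgroup.mem_carrier[OF D]
  have sc: "s k \<in> carrier G" if "k \<in> K" for k using hom_in_carrier[OF s] that by simp
  have sm: "s (k \<otimes> l) = s k \<otimes> s l" if "k \<in> K" "l \<in> K" for k l using hom_mult[OF s] that by simp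
  interpret q: group_hom G "G Mod B" "\<lambda>x. B #> x" using normal_coset_hom[OF B] .
  interpret GK: group "G\<lparr>carrier := K\<rparr>" using K by (rule subgroup.subgroup_is_group) auto
  have WN: "W \<lhd> G\<lparr>carrier := K\<rparr>"
    using GK.normal_inv_iff subgroup_incl[OF W(1) K W(2)] WK K by (simp add: m_inv_consistent)
  interpret Q: group "G\<lparr>carrier := K\<rparr> Mod W" using WN by (rule normal.factorgroup_is_group)
  interpret qK: group_hom "G\<lparr>carrier := K\<rparr>" "G\<lparr>carrier := K\<rparr> Mod W" "\<lambda>x. W #>\<^bsub>G\<lparr>carrier := K\<rparr>\<^esub> x"
    using GK.normal_coset_hom[OF WN] .
  define \<Omega> where "\<Omega> = carrier (G\<lparr>carrier := K\<rparr> Mod W)"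
  define c where "c k = s k \<otimes> inv k" for k
  define f where "f \<omega> = B #> c (SOME t. t \<in> \<omega>)" for \<omega>
  define act where "act k \<omega> = (W #> k) \<otimes>\<^bsub>G\<lparr>carrier := K\<rparr> Mod W\<^esub> \<omega>" for k \<omega>
  have \<Omega>: "\<omega> \<in> \<Omega> \<longleftrightarrow> (\<exists>t\<in>K. \<omega> = W #> t)" for \<omega>
    by (auto simp: \<Omega>_def carrier_FactGroup)
  have fW: "f (W #> t) = B #> c t" if t: "t \<in> K" for t
  proof -
    have "t \<in> W #> t" using rcos_self[OF Kc[OF t] W(1)] .
    then have "(SOME t'. t' \<in> W #> t) \<in> W #> t" by (rule someI)
    then obtain w where w: "w \<in> W" "(SOME t'. t' \<in> W #> t) = w \<otimes> t" by (auto simp: r_coset_def)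
    have wK: "w \<in> K" using w(1) W(2) by blast
    have "c (w \<otimes> t) = w \<otimes> c t \<otimes> inv w"
      using sm[OF wK t] sW[OF w(1)] Wc[OF w(1)] Kc[OF t] sc[OF t] by (simp add: c_def word_simps)
    also have "\<dots> = c t \<otimes> w \<otimes> inv w" using DW[OF sD[OF t] w(1)] by (simp add: c_def)
    also have "\<dots> = c t" using Wc[OF w(1)] Kc[OF t] sc[OF t] by (simp add: c_def word_simps)
    finally show ?thesis by (simp add: f_def w(2))
  qed
  have actW: "act k (W #> t) = W #> (k \<otimes> t)" if "k \<in> K" "t \<in> K" for k t
    using qK.hom_mult[of k t] that by (simp add: act_def)
  have card\<Omega>: "coprime (card \<Omega>) M" using ind by (simp add: \<Omega>_def FactGroup_def)
  have "\<exists>u. [card \<Omega> * u = 1] (mod M)" using cong_solve_coprime_nat[OF card\<Omega>] by simp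
  then obtain u where u: "[card \<Omega> * u = 1] (mod M)" ..
  have "\<exists>b\<in>(\<lambda>x. B #> x) ` D. \<forall>k\<in>K. B #> c k =
      b \<otimes>\<^bsub>G Mod B\<^esub> (B #> k) \<otimes>\<^bsub>G Mod B\<^esub> inv\<^bsub>G Mod B\<^esub> b \<otimes>\<^bsub>G Mod B\<^esub> inv\<^bsub>G Mod B\<^esub> (B #> k)"
  proof (rule q.H.averaging_coboundary)
    show "subgroup ((\<lambda>x. B #> x) ` D) (G Mod B)" using q.subgroup_img_is_subgroup[OF D] .
    fix x y assume "x \<in> (\<lambda>x. B #> x) ` D" "y \<in> (\<lambda>x. B #> x) ` D"
    then obtain a b where ab: "a \<in> D" "b \<in> D" and xy: "x = B #> a" "y = B #> b" by blast
    note cr = Dc[OF ab(1)] Dc[OF ab(2)]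
    have "B #> (a \<otimes> b \<otimes> inv a \<otimes> inv b) = \<one>\<^bsub>G Mod B\<^esub>"
      using coset_eq_one_iff[OF B, of "a \<otimes> b \<otimes> inv a \<otimes> inv b"] DB[OF ab] cr by blast
    then have "(B #> (a \<otimes> b \<otimes> inv a \<otimes> inv b)) \<otimes>\<^bsub>G Mod B\<^esub> (B #> (b \<otimes> a)) = B #> (b \<otimes> a)"
      using cr q.hom_closed[of "b \<otimes> a"] q.H.l_one by (metis m_closed)
    moreover have "(B #> (a \<otimes> b \<otimes> inv a \<otimes> inv b)) \<otimes>\<^bsub>G Mod B\<^esub> (B #> (b \<otimes> a))
        = B #> ((a \<otimes> b \<otimes> inv a \<otimes> inv b) \<otimes> (b \<otimes> a))" by (rule q.hom_mult[symmetric]) (use cr in auto)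
    moreover have "(a \<otimes> b \<otimes> inv a \<otimes> inv b) \<otimes> (b \<otimes> a) = a \<otimes> b" using cr by (simp add: word_simps)
    ultimately have "B #> (a \<otimes> b) = B #> (b \<otimes> a)" by simp
    then show "x \<otimes>\<^bsub>G Mod B\<^esub> y = y \<otimes>\<^bsub>G Mod B\<^esub> x"
      using q.hom_mult[OF cr] q.hom_mult[OF cr(2,1)] xy by simp
  next
    fix k e assume k: "k \<in> K" and "e \<in> (\<lambda>x. B #> x) ` D"
    then obtain d where d: "d \<in> D" "e = B #> d" by blast
    have "(B #> k) \<otimes>\<^bsub>G Mod B\<^esub> e \<otimes>\<^bsub>G Mod B\<^esub> inv\<^bsub>G Mod B\<^esub> (B #> k) = B #> (k \<otimes> d \<otimes> inv k)"
      using Kc[OF k] Dc[OF d(1)] d(2) by (simp del: mult_FactGroup)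
    then show "(B #> k) \<otimes>\<^bsub>G Mod B\<^esub> e \<otimes>\<^bsub>G Mod B\<^esub> inv\<^bsub>G Mod B\<^esub> (B #> k) \<in> (\<lambda>x. B #> x) ` D"
      using DK[OF k d(1)] by simp
  next
    show "finite \<Omega>" using finite_subset[OF subgroup.subset[OF K] fin] by (simp add: \<Omega>_def carrier_FactGroup)
  next
    fix k assume k: "k \<in> K"
    show "B #> k \<in> carrier (G Mod B)" using Kc[OF k] by simp
    show "B #> c k \<in> (\<lambda>x. B #> x) ` D" using sD[OF k] by (simp add: c_def)
    have Wk: "W #> k \<in> carrier (G\<lparr>carrier := K\<rparr> Mod W)" using k \<Omega> \<Omega>_def by blast
    show "bij_betw (act k) \<Omega> \<Omega>"
      unfolding \<Omega>_def act_def
      by (rule bij_betw_byWitness[where f' = "\<lambda>x. inv\<^bsub>G\<lparr>carrier := K\<rparr> Mod W\<^esub> (W #> k) \<otimes>\<^bsub>G\<lparr>carrier := K\<rparr> Mod W\<^esub> x"])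
        (use Wk Q.inv_mult_cancel[OF Wk] Q.m_closed Q.inv_closed in \<open>auto simp del: mult_FactGroup\<close>)
    have cc: "c k \<in> carrier G" using sc[OF k] Kc[OF k] by (simp add: c_def)
    have "c k [^] (card \<Omega> * u) = c k"
      using pow_cong[OF cc _ u] M[OF sD[OF k]] cc by (simp add: c_def)
    then show "(B #> c k) [^]\<^bsub>G Mod B\<^esub> (card \<Omega> * u) = B #> c k"
      using q.hom_nat_pow[OF cc] by metis
    fix \<omega> assume "\<omega> \<in> \<Omega>"
    then obtain t where t: "t \<in> K" "\<omega> = W #> t" using \<Omega> by blast
    have "c (k \<otimes> t) = c k \<otimes> (k \<otimes> c t \<otimes> inv k)"
      using sm[OF k t(1)] Kc[OF k] Kc[OF t(1)] sc[OF k] sc[OF t(1)] by (simp add: c_def word_simps)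
    then have "f (act k \<omega>) = B #> (c k \<otimes> (k \<otimes> c t \<otimes> inv k))"
      using fW[of "k \<otimes> t"] actW[OF k t(1)] k t subgroup.m_closed[OF K] by simp
    moreover have "c t \<in> carrier G" using sc[OF t(1)] Kc[OF t(1)] by (simp add: c_def)
    ultimately show "f (act k \<omega>) = (B #> c k) \<otimes>\<^bsub>G Mod B\<^esub>
        ((B #> k) \<otimes>\<^bsub>G Mod B\<^esub> f \<omega> \<otimes>\<^bsub>G Mod B\<^esub> inv\<^bsub>G Mod B\<^esub> (B #> k))"
      using cc Kc[OF k] fW[OF t(1)] t(2) by (simp del: mult_FactGroup)
  next
    fix \<omega> assume "\<omega> \<in> \<Omega>"
    then show "f \<omega> \<in> (\<lambda>x. B #> x) ` D" using \<Omega> fW sD by (force simp: c_def)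
  qed
  then obtain b where b: "b \<in> D" and eq: "\<And>k. k \<in> K \<Longrightarrow> B #> c k =
      (B #> b) \<otimes>\<^bsub>G Mod B\<^esub> (B #> k) \<otimes>\<^bsub>G Mod B\<^esub> inv\<^bsub>G Mod B\<^esub> (B #> b) \<otimes>\<^bsub>G Mod B\<^esub> inv\<^bsub>G Mod B\<^esub> (B #> k)"
    by (auto simp del: mult_FactGroup)
  have "inv b \<otimes> s k \<otimes> b \<otimes> inv k \<in> B" if k: "k \<in> K" for k
  proof -
    note cr = Dc[OF b] Kc[OF k] sc[OF k]
    have cc: "c k \<in> carrier G" using cr by (simp add: c_def)
    have "inv b \<otimes> s k \<otimes> b \<otimes> inv k = inv b \<otimes> c k \<otimes> (k \<otimes> b \<otimes> inv k)" using cr by (simp add: c_def word_simps)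
    then have "B #> (inv b \<otimes> s k \<otimes> b \<otimes> inv k) = inv\<^bsub>G Mod B\<^esub> (B #> b) \<otimes>\<^bsub>G Mod B\<^esub> (B #> c k) \<otimes>\<^bsub>G Mod B\<^esub>
       ((B #> k) \<otimes>\<^bsub>G Mod B\<^esub> (B #> b) \<otimes>\<^bsub>G Mod B\<^esub> inv\<^bsub>G Mod B\<^esub> (B #> k))"
      using cr cc by (simp del: mult_FactGroup)
    also have "\<dots> = \<one>\<^bsub>G Mod B\<^esub>"
      unfolding eq[OF k] using cr by (simp add: q.H.word_simps del: mult_FactGroup one_FactGroup)
    finally show ?thesis
      using coset_eq_one_iff[OF B, of "inv b \<otimes> s k \<otimes> b \<otimes> inv k"] cr by blast
  qed
  then show ?thesis using b by blast
qed

end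

section \<open>The common centralizer of the factors of a cyclic series\<close>

definition series_centralizer :: "('a, 'b) monoid_scheme \<Rightarrow> (nat \<Rightarrow> 'a set) \<Rightarrow> nat \<Rightarrow> 'a set"
  where "series_centralizer G H n = {g \<in> carrier G. \<forall>i<n. \<forall>x\<in>H (Suc i).
    g \<otimes>\<^bsub>G\<^esub> x \<otimes>\<^bsub>G\<^esub> inv\<^bsub>G\<^esub> g \<otimes>\<^bsub>G\<^esub> inv\<^bsub>G\<^esub> x \<in> H i}"

context group
begin

text \<open>The commutator with a product or a conjugate is a product of conjugates of commutators,
and every term of the series is normal.\<close>

lemma series_centralizer_normal:
  assumes ns: "normal_series G H n"
  shows "series_centralizer G H n \<lhd> G"
proof -
  define V where "V = series_centralizer G H n"
  have VD: "g \<in> carrier G" "\<And>i x. i < n \<Longrightarrow> x \<in> H (Suc i) \<Longrightarrow> g \<otimes> x \<otimes> inv g \<otimes> inv x \<in> H i"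
    if "g \<in> V" for g using that by (auto simp: V_def series_centralizer_def)
  have H: "H i \<lhd> G" if "i \<le> n" for i using that ns by (simp add: normal_series_def)
  have Hcar: "x \<in> carrier G" if "i < n" "x \<in> H (Suc i)" for i x
    using subgroup.mem_carrier[OF normal_imp_subgroup[OF H[of "Suc i"]] that(2)] that(1) by simp
  have VI: "g \<in> V" if "g \<in> carrier G"
    "\<And>i x. i < n \<Longrightarrow> x \<in> H (Suc i) \<Longrightarrow> x \<in> carrier G \<Longrightarrow> g \<otimes> x \<otimes> inv g \<otimes> inv x \<in> H i" for g
    using that Hcar by (simp add: V_def series_centralizer_def)
  have Hm: "x \<otimes> y \<in> H i" if "i \<le> n" "x \<in> H i" "y \<in> H i" for i x y
    using subgroup.m_closed[OF normal_imp_subgroup[OF H[OF that(1)]] that(2,3)] .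
  have Hi: "inv x \<in> H i" if "i \<le> n" "x \<in> H i" for i x
    using subgroup.m_inv_closed[OF normal_imp_subgroup[OF H[OF that(1)]] that(2)] .
  have Hc: "g \<otimes> x \<otimes> inv g \<in> H i" if "i \<le> n" "x \<in> H i" "g \<in> carrier G" for i x g
    using normal.inv_op_closed2[OF H[OF that(1)] that(3,2)] .
  have Hc': "inv g \<otimes> x \<otimes> g \<in> H i" if "i \<le> n" "x \<in> H i" "g \<in> carrier G" for i x g
    using normal.inv_op_closed1[OF H[OF that(1)] that(3,2)] .
  have "subgroup V G"
  proof (rule subgroupI)
    show "V \<subseteq> carrier G" using VD(1) by blast
    have "\<one> \<in> V"
    proof (rule VI)
      fix i x assume "i < n" "x \<in> carrier G"
      then show "\<one> \<otimes> x \<otimes> inv \<one> \<otimes> inv x \<in> H i"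
        using subgroup.one_closed[OF normal_imp_subgroup[OF H[of i]]] by simp
    qed simp
    then show "V \<noteq> {}" by blast
  next
    fix g assume g: "g \<in> V"
    show "inv g \<in> V"
    proof (rule VI)
      fix i x assume x: "i < n" "x \<in> H (Suc i)" "x \<in> carrier G"
      have "inv (inv g \<otimes> (g \<otimes> x \<otimes> inv g \<otimes> inv x) \<otimes> g) \<in> H i"
        using Hi Hc' VD(2)[OF g x(1,2)] VD(1)[OF g] x(1) by simp
      then show "inv g \<otimes> x \<otimes> inv (inv g) \<otimes> inv x \<in> H i"
        using VD(1)[OF g] x(3) by (simp add: word_simps)
    qed (use VD g in simp)
  next
    fix g h assume g: "g \<in> V" and h: "h \<in> V"
    show "g \<otimes> h \<in> V"
    proof (rule VI)
      fix i x assume x: "i < n" "x \<in> H (Suc i)" "x \<in> carrier G"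
      have "g \<otimes> (h \<otimes> x \<otimes> inv h \<otimes> inv x) \<otimes> inv g \<otimes> (g \<otimes> x \<otimes> inv g \<otimes> inv x) \<in> H i"
        by (rule Hm) (use Hc VD(2)[OF g x(1,2)] VD(2)[OF h x(1,2)] VD(1)[OF g] x(1) in auto)
      then show "g \<otimes> h \<otimes> x \<otimes> inv (g \<otimes> h) \<otimes> inv x \<in> H i"
        using VD(1)[OF g] VD(1)[OF h] x(3) by (simp add: word_simps)
    qed (use VD g h in simp)
  qed
  moreover have "h \<otimes> g \<otimes> inv h \<in> V" if h: "h \<in> carrier G" and g: "g \<in> V" for h g
  proof (rule VI)
    fix i x assume x: "i < n" "x \<in> H (Suc i)" "x \<in> carrier G"
    have "inv h \<otimes> x \<otimes> h \<in> H (Suc i)" using Hc' x h by simp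
    from VD(2)[OF g x(1) this]
    have "h \<otimes> (g \<otimes> (inv h \<otimes> x \<otimes> h) \<otimes> inv g \<otimes> inv (inv h \<otimes> x \<otimes> h)) \<otimes> inv h \<in> H i"
      using Hc x h by simp
    then show "h \<otimes> g \<otimes> inv h \<otimes> x \<otimes> inv (h \<otimes> g \<otimes> inv h) \<otimes> inv x \<in> H i"
      using VD(1)[OF g] x(3) h by (simp add: word_simps)
  qed (use VD(1)[OF g] h in simp)
  ultimately show ?thesis unfolding normal_inv_iff V_def by blast
qed

lemma int_pow_conj:
  assumes "g \<in> carrier G" "x \<in> carrier G"
  shows "(g \<otimes> x \<otimes> inv g) [^] (k::int) = g \<otimes> x [^] k \<otimes> inv g"
proof (cases k rule: int_cases2)
  case (nonneg m)
  then show ?thesis using pow_conj[OF assms] by (simp add: int_pow_int)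
next
  case (nonpos m)
  have "(g \<otimes> x \<otimes> inv g) [^] k = inv (g \<otimes> x [^] m \<otimes> inv g)"
    using int_pow_neg_int[of "g \<otimes> x \<otimes> inv g" m] pow_conj[OF assms] assms nonpos by simp
  then show ?thesis using int_pow_neg_int[of x m] assms nonpos by (simp add: word_simps)
qed

text \<open>Automorphisms of a cyclic group are power maps, and power maps commute.\<close>

lemma conj_power_commute:
  assumes c: "g \<in> carrier G" "h \<in> carrier G" "y \<in> carrier G"
    and g: "g \<otimes> y \<otimes> inv g = y [^] (r::int)" and h: "h \<otimes> y \<otimes> inv h = y [^] (t::int)"
    and x: "x = y [^] (l::int)"
  shows "(g \<otimes> h) \<otimes> x \<otimes> inv (g \<otimes> h) = (h \<otimes> g) \<otimes> x \<otimes> inv (h \<otimes> g)"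
proof -
  have *: "(a \<otimes> b) \<otimes> x \<otimes> inv (a \<otimes> b) = y [^] (i * j * l)"
    if ab: "a \<in> carrier G" "b \<in> carrier G" "a \<otimes> y \<otimes> inv a = y [^] i" "b \<otimes> y \<otimes> inv b = y [^] j" for a b and i j :: int
  proof -
    have "(a \<otimes> b) \<otimes> x \<otimes> inv (a \<otimes> b) = a \<otimes> (b \<otimes> y [^] l \<otimes> inv b) \<otimes> inv a"
      using ab(1,2) c by (simp add: x word_simps)
    also have "b \<otimes> y [^] l \<otimes> inv b = y [^] (j * l)"
      using int_pow_conj[OF ab(2) c(3), of l] c(3) by (simp add: ab(4) int_pow_pow)
    also have "a \<otimes> y [^] (j * l) \<otimes> inv a = y [^] (i * (j * l))"
      using int_pow_conj[OF ab(1) c(3), of "j * l"] c(3) by (simp add: ab(3) int_pow_pow)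
    finally show ?thesis by (simp add: mult.assoc)
  qed
  show ?thesis using *[OF c(1,2) g h] *[OF c(2,1) h g] by (simp add: mult.commute)
qed

lemma factor_group_eq:
  "G\<lparr>carrier := S\<rparr> Mod A = (G Mod A)\<lparr>carrier := (\<lambda>x. A #> x) ` S\<rparr>"
  by (auto simp: FactGroup_def RCOSETS_def set_mult_def fun_eq_iff)

lemma cyclic_factor_generator:
  assumes A: "A \<lhd> G" and S: "S \<lhd> G" and cyc: "cyclic_group (G\<lparr>carrier := S\<rparr> Mod A)"
  shows "\<exists>y\<in>S. \<forall>x\<in>S. \<exists>l::int. A #> x = (A #> y) [^]\<^bsub>G Mod A\<^esub> l"
proof -
  interpret q: group_hom G "G Mod A" "\<lambda>x. A #> x" using normal_coset_hom[OF A] .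
  have S': "subgroup S G" using S normal_imp_subgroup by blast
  have img: "subgroup ((\<lambda>x. A #> x) ` S) (G Mod A)" using q.subgroup_img_is_subgroup[OF S'] .
  interpret F: group "(G Mod A)\<lparr>carrier := (\<lambda>x. A #> x) ` S\<rparr>"
    using img by (rule subgroup.subgroup_is_group) (rule q.H.is_group)
  have carr: "carrier ((G Mod A)\<lparr>carrier := (\<lambda>x. A #> x) ` S\<rparr>) = (\<lambda>x. A #> x) ` S" by simp
  have "cyclic_group ((G Mod A)\<lparr>carrier := (\<lambda>x. A #> x) ` S\<rparr>)"
    using cyc by (simp only: factor_group_eq)
  then obtain Y where Y: "Y \<in> (\<lambda>x. A #> x) ` S"
    and gen: "(\<lambda>x. A #> x) ` S = range (\<lambda>l::int. Y [^]\<^bsub>(G Mod A)\<lparr>carrier := (\<lambda>x. A #> x) ` S\<rparr>\<^esub> l)"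
    unfolding F.cyclic_group carr by (elim bexE)
  obtain y where y: "y \<in> S" "Y = A #> y" using Y by blast
  have "\<exists>l::int. A #> x = (A #> y) [^]\<^bsub>G Mod A\<^esub> l" if "x \<in> S" for x
  proof -
    have "A #> x \<in> range (\<lambda>l::int. Y [^]\<^bsub>(G Mod A)\<lparr>carrier := (\<lambda>x. A #> x) ` S\<rparr>\<^esub> l)" using gen that by blast
    then show ?thesis using q.H.int_pow_consistent[OF img Y] y(2) by auto
  qed
  then show ?thesis using y by blast
qed

text \<open>The actions of \<open>g\<close> and \<open>h\<close> on a cyclic factor commute, so their commutator acts trivially. Here
cyclicity of the factors, as opposed to mere commutativity, enters the proof.\<close>

lemma cyclic_factor_commutators:
  assumes A: "A \<lhd> G" and S: "S \<lhd> G" and cyc: "cyclic_group (G\<lparr>carrier := S\<rparr> Mod A)"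
  shows "\<And>x y. x \<in> S \<Longrightarrow> y \<in> S \<Longrightarrow> x \<otimes> y \<otimes> inv x \<otimes> inv y \<in> A"
    and "\<And>g h x. g \<in> carrier G \<Longrightarrow> h \<in> carrier G \<Longrightarrow> x \<in> S \<Longrightarrow>
      (g \<otimes> h \<otimes> inv g \<otimes> inv h) \<otimes> x \<otimes> inv (g \<otimes> h \<otimes> inv g \<otimes> inv h) \<otimes> inv x \<in> A"
proof -
  interpret q: group_hom G "G Mod A" "\<lambda>x. A #> x" using normal_coset_hom[OF A] .
  note Sc = subgroup.mem_carrier[OF normal_imp_subgroup[OF S]]
  obtain y where y: "y \<in> S" and gen: "\<And>x. x \<in> S \<Longrightarrow> \<exists>l::int. A #> x = (A #> y) [^]\<^bsub>G Mod A\<^esub> l"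
    using cyclic_factor_generator[OF assms] by blast
  have yc: "A #> y \<in> carrier (G Mod A)" using Sc[OF y] by simp
  show "u \<otimes> v \<otimes> inv u \<otimes> inv v \<in> A" if uv: "u \<in> S" "v \<in> S" for u v
  proof -
    obtain i j :: int where "A #> u = (A #> y) [^]\<^bsub>G Mod A\<^esub> i" "A #> v = (A #> y) [^]\<^bsub>G Mod A\<^esub> j"
      using gen uv by metis
    then have "(A #> u) \<otimes>\<^bsub>G Mod A\<^esub> (A #> v) = (A #> v) \<otimes>\<^bsub>G Mod A\<^esub> (A #> u)"
      using q.H.int_pow_mult[OF yc] by (metis add.commute)
    moreover have "A #> (u \<otimes> v \<otimes> inv u \<otimes> inv v) = (A #> u) \<otimes>\<^bsub>G Mod A\<^esub> (A #> v)
        \<otimes>\<^bsub>G Mod A\<^esub> inv\<^bsub>G Mod A\<^esub> (A #> u) \<otimes>\<^bsub>G Mod A\<^esub> inv\<^bsub>G Mod A\<^esub> (A #> v)"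
      using Sc uv by (simp del: mult_FactGroup)
    ultimately have "A #> (u \<otimes> v \<otimes> inv u \<otimes> inv v) = \<one>\<^bsub>G Mod A\<^esub>"
      using Sc uv by (simp add: q.H.word_simps del: mult_FactGroup one_FactGroup)
    then show ?thesis using coset_eq_one_iff[OF A, of "u \<otimes> v \<otimes> inv u \<otimes> inv v"] Sc uv by blast
  qed
  show "(g \<otimes> h \<otimes> inv g \<otimes> inv h) \<otimes> x \<otimes> inv (g \<otimes> h \<otimes> inv g \<otimes> inv h) \<otimes> inv x \<in> A"
    if gh: "g \<in> carrier G" "h \<in> carrier G" and x: "x \<in> S" for g h x
  proof -
    have conj: "\<exists>r::int. (A #> k) \<otimes>\<^bsub>G Mod A\<^esub> (A #> y) \<otimes>\<^bsub>G Mod A\<^esub> inv\<^bsub>G Mod A\<^esub> (A #> k) = (A #> y) [^]\<^bsub>G Mod A\<^esub> r"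
      if "k \<in> carrier G" for k
    proof -
      have "k \<otimes> y \<otimes> inv k \<in> S" using normal.inv_op_closed2[OF S that y] .
      from gen[OF this] show ?thesis using that Sc[OF y] by (simp del: mult_FactGroup)
    qed
    \<comment> \<open>chosen so that \<open>h g\<close> carries it to \<open>x\<close>, and \<open>g h\<close> to the conjugate of \<open>x\<close> by the commutator\<close>
    define x' where "x' = inv (h \<otimes> g) \<otimes> x \<otimes> (h \<otimes> g)"
    have x': "x' \<in> S" using normal.inv_op_closed1[OF S, of "h \<otimes> g" x] gh x by (simp add: x'_def)
    obtain r t l :: int where rtl:
      "(A #> g) \<otimes>\<^bsub>G Mod A\<^esub> (A #> y) \<otimes>\<^bsub>G Mod A\<^esub> inv\<^bsub>G Mod A\<^esub> (A #> g) = (A #> y) [^]\<^bsub>G Mod A\<^esub> r"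
      "(A #> h) \<otimes>\<^bsub>G Mod A\<^esub> (A #> y) \<otimes>\<^bsub>G Mod A\<^esub> inv\<^bsub>G Mod A\<^esub> (A #> h) = (A #> y) [^]\<^bsub>G Mod A\<^esub> t"
      "A #> x' = (A #> y) [^]\<^bsub>G Mod A\<^esub> l"
      using conj[OF gh(1)] conj[OF gh(2)] gen[OF x'] by blast
    note cr = gh Sc[OF x] Sc[OF x']
    have "A #> ((g \<otimes> h) \<otimes> x' \<otimes> inv (g \<otimes> h)) = A #> ((h \<otimes> g) \<otimes> x' \<otimes> inv (h \<otimes> g))"
      using q.H.conj_power_commute[OF q.hom_closed[OF gh(1)] q.hom_closed[OF gh(2)] yc rtl] cr
      by (simp del: mult_FactGroup)
    also have "(h \<otimes> g) \<otimes> x' \<otimes> inv (h \<otimes> g) = x" using cr by (simp add: x'_def word_simps)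
    also have "(g \<otimes> h) \<otimes> x' \<otimes> inv (g \<otimes> h) = (g \<otimes> h \<otimes> inv g \<otimes> inv h) \<otimes> x \<otimes> inv (g \<otimes> h \<otimes> inv g \<otimes> inv h)"
      using cr by (simp add: x'_def word_simps)
    finally have eq: "A #> ((g \<otimes> h \<otimes> inv g \<otimes> inv h) \<otimes> x \<otimes> inv (g \<otimes> h \<otimes> inv g \<otimes> inv h)) = A #> x" .
    define z where "z = (g \<otimes> h \<otimes> inv g \<otimes> inv h) \<otimes> x \<otimes> inv (g \<otimes> h \<otimes> inv g \<otimes> inv h)"
    have zc: "z \<in> carrier G" using cr by (simp add: z_def)
    have "A #> (z \<otimes> inv x) = (A #> z) \<otimes>\<^bsub>G Mod A\<^esub> inv\<^bsub>G Mod A\<^esub> (A #> x)"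
      using zc cr by (simp del: mult_FactGroup)
    also have "\<dots> = \<one>\<^bsub>G Mod A\<^esub>" using eq cr by (simp add: z_def[symmetric] del: mult_FactGroup one_FactGroup)
    finally show ?thesis using coset_eq_one_iff[OF A, of "z \<otimes> inv x"] zc cr by (simp add: z_def)
  qed
qed

text \<open>An automorphism that is trivial on the factors of a series of length \<open>n\<close> of \<open>P\<close> has order dividing \<open>M\<^sup>n\<close>,
where \<open>M\<close> is an exponent of \<open>P\<close>: going up the series, if \<open>w\<close> centralizes one term and
\<open>w x w\<^sup>-\<^sup>1 = z x\<close> with \<open>z\<close> in that term, then \<open>w\<^sup>M x w\<^sup>-\<^sup>M = z\<^sup>M x = x\<close>.\<close>

lemma series_centralizer_power_centralizes:
  assumes ns: "normal_series G H n" and v: "v \<in> series_centralizer G H n"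
    and P: "P \<lhd> G" and M: "\<And>x. x \<in> P \<Longrightarrow> x [^] (M::nat) = \<one>"
    and x: "x \<in> P"
  shows "v [^] (M ^ n) \<otimes> x = x \<otimes> v [^] (M ^ n)"
proof -
  have vc: "v \<in> carrier G" using v by (simp add: series_centralizer_def)
  have V: "subgroup (series_centralizer G H n) G" using series_centralizer_normal[OF ns] normal_imp_subgroup by blast
  have pow: "v [^] (k::nat) \<in> series_centralizer G H n" for k
    by (induction k) (use v V subgroup.one_closed subgroup.m_closed in force)+
  note Pc = subgroup.mem_carrier[OF normal_imp_subgroup[OF P]]
  have main: "v [^] (M ^ i) \<otimes> x = x \<otimes> v [^] (M ^ i)" if "i \<le> n" "x \<in> P" "x \<in> H i" for i x
    using that
  proof (induction i arbitrary: x)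
    case 0
    then show ?case using ns vc by (simp add: normal_series_def)
  next
    case (Suc i)
    define w where "w = v [^] (M ^ i)"
    have wc: "w \<in> carrier G" using vc by (simp add: w_def)
    have xc: "x \<in> carrier G" using Pc Suc.prems by simp
    define z where "z = w \<otimes> x \<otimes> inv w \<otimes> inv x"
    have zc: "z \<in> carrier G" using wc xc by (simp add: z_def)
    have "z \<in> H i" using pow[of "M ^ i"] Suc.prems by (auto simp: series_centralizer_def z_def w_def)
    moreover have zP: "z \<in> P"
      unfolding z_def by (rule subgroup.m_closed[OF normal_imp_subgroup[OF P]])
        (use normal.inv_op_closed2[OF P wc] subgroup.m_inv_closed[OF normal_imp_subgroup[OF P]] Suc.prems in auto)
    ultimately have "w \<otimes> z = z \<otimes> w" unfolding w_def using Suc.IH Suc.prems by simp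
    moreover have "w \<otimes> x = z \<otimes> (x \<otimes> w)" using wc xc by (simp add: z_def word_simps)
    ultimately have "w [^] M \<otimes> x = z [^] M \<otimes> (x \<otimes> w [^] M)"
      using central_commutator_pow_eq[OF wc xc zc] by simp
    then have "w [^] M \<otimes> x = x \<otimes> w [^] M" using M[OF zP] wc xc by simp
    then show ?case using vc by (simp add: w_def nat_pow_pow mult.commute)
  qed
  have "x \<in> H n" using ns Pc[OF x] by (simp add: normal_series_def)
  then show ?thesis using main[of n x] x by simp
qed

section \<open>Homomorphisms that differ from the inclusion by a p-group\<close>

lemma conj_hom_restrict:
  assumes K: "subgroup K G" and s: "s \<in> hom (G\<lparr>carrier := K\<rparr>) G" and b: "b \<in> carrier G"
  shows "(\<lambda>k. inv b \<otimes> s k \<otimes> b) \<in> hom (G\<lparr>carrier := K\<rparr>) G"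
proof (rule homI)
  fix k assume "k \<in> carrier (G\<lparr>carrier := K\<rparr>)"
  then show "inv b \<otimes> s k \<otimes> b \<in> carrier G" using hom_in_carrier[OF s] b by simp
next
  fix k l assume kl: "k \<in> carrier (G\<lparr>carrier := K\<rparr>)" "l \<in> carrier (G\<lparr>carrier := K\<rparr>)"
  then show "inv b \<otimes> s (k \<otimes>\<^bsub>G\<lparr>carrier := K\<rparr>\<^esub> l) \<otimes> b = inv b \<otimes> s k \<otimes> b \<otimes> (inv b \<otimes> s l \<otimes> b)"
    using hom_in_carrier[OF s kl(1)] hom_in_carrier[OF s kl(2)] hom_mult[OF s kl] b by (simp add: word_simps)
qed

lemma commute_if_coprime_power_commutes:
  assumes "y \<in> carrier G" "x \<in> carrier G" "y [^] (m::nat) \<otimes> x = x \<otimes> y [^] m"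
    and "y [^] (N::nat) = \<one>" "coprime m N"
  shows "y \<otimes> x = x \<otimes> y"
proof -
  obtain l where "[m * l = 1] (mod N)" using cong_solve_coprime_nat[OF assms(5)] by auto
  then have "(y [^] m) [^] l = y" using pow_cong[OF assms(1,4)] assms(1) by (simp add: nat_pow_pow)
  then show ?thesis using group_commutes_pow[OF assms(3), of l] assms by simp
qed

text \<open>If \<open>s y = z y\<close> with \<open>z\<close> and \<open>y\<close> commuting, then every exponent that kills \<open>y\<close>
kills \<open>s y\<close> and hence \<open>z\<close>, which has an exponent coprime to it by assumption.\<close>

lemma hom_eq_if_commuting_coprime:
  assumes K: "subgroup K G" and s: "s \<in> hom (G\<lparr>carrier := K\<rparr>) G"
    and y: "y \<in> K" "y [^] (N::nat) = \<one>" and c: "(s y \<otimes> inv y) [^] (M::nat) = \<one>"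
    and com: "y \<otimes> (s y \<otimes> inv y) = (s y \<otimes> inv y) \<otimes> y" and "coprime M N"
  shows "s y = y"
proof -
  interpret KG: group "G\<lparr>carrier := K\<rparr>" using K by (rule subgroup.subgroup_is_group) auto
  interpret s: group_hom "G\<lparr>carrier := K\<rparr>" G s
    by (simp add: group_hom_def group_hom_axioms_def s KG.is_group)
  have yc: "y \<in> carrier G" using subgroup.mem_carrier[OF K y(1)] .
  have sy: "s y \<in> carrier G" using y(1) by simp
  define z where "z = s y \<otimes> inv y"
  have zc: "z \<in> carrier G" using yc sy by (simp add: z_def)
  have syz: "s y = z \<otimes> y" using yc sy by (simp add: z_def word_simps)
  have "y [^]\<^bsub>G\<lparr>carrier := K\<rparr>\<^esub> N = \<one>\<^bsub>G\<lparr>carrier := K\<rparr>\<^esub>"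
    using y(2) nat_pow_consistent[of y N K] by simp
  then have "s y [^] N = \<one>" using s.hom_nat_pow[of y N] y(1) s.hom_one by simp
  moreover have "s y [^] N = z [^] N \<otimes> y [^] N"
    unfolding syz by (rule pow_mult_distrib) (use com zc yc in \<open>auto simp: z_def\<close>)
  ultimately have "z [^] N = \<one>" using y(2) zc by simp
  then have "z = \<one>" using eq_one_if_coprime_powers[OF zc _ _ assms(7)] c by (simp add: z_def)
  then show ?thesis using syz yc by simp
qed

text \<open>Local triviality on a Sylow subgroup extends to a normal subgroup of \<open>K\<close>: modulo the
subgroup \<open>V\<close> of elements trivial on all factors, \<open>G\<close> is abelian, so the elements whose
\<open>|Q|\<close>-th power lies in \<open>V\<close> form a normal subgroup \<open>W\<close>. Its elements of order prime to \<open>p\<close> centralize \<open>P\<close>, because a \<open>p\<close>-power of them does, and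
are therefore fixed by \<open>s\<close>. So the fixed points of \<open>s\<close> in \<open>W\<close> contain a Sylow subgroup for every prime.\<close>

lemma hom_identity_on_normal_subgroup:
  assumes fin: "finite (carrier G)" and p: "Factorial_Ring.prime (p::nat)"
    and ns: "normal_series G H n"
    and comV: "\<And>g h. g \<in> carrier G \<Longrightarrow> h \<in> carrier G \<Longrightarrow> g \<otimes> h \<otimes> inv g \<otimes> inv h \<in> series_centralizer G H n"
    and P: "P \<lhd> G" and M: "\<And>x. x \<in> P \<Longrightarrow> x [^] (p ^ a) = \<one>"
    and K: "subgroup K G" and s: "s \<in> hom (G\<lparr>carrier := K\<rparr>) G"
    and sP: "\<And>k. k \<in> K \<Longrightarrow> s k \<otimes> inv k \<in> P"
    and Q: "subgroup Q G" "Q \<subseteq> K" "card Q = p ^ multiplicity p (card K)" "\<And>x. x \<in> Q \<Longrightarrow> s x = x"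
  shows "\<exists>W. subgroup W G \<and> Q \<subseteq> W \<and> W \<subseteq> K \<and> (\<forall>k\<in>K. \<forall>w\<in>W. k \<otimes> w \<otimes> inv k \<in> W) \<and> (\<forall>w\<in>W. s w = w)"
proof -
  define V where "V = series_centralizer G H n"
  have V: "V \<lhd> G" unfolding V_def by (rule series_centralizer_normal[OF ns])
  interpret q: group_hom G "G Mod V" "\<lambda>x. V #> x" using normal_coset_hom[OF V] .
  note Kc = subgroup.mem_carrier[OF K] and Pc = subgroup.mem_carrier[OF normal_imp_subgroup[OF P]]
  have sc: "s k \<in> carrier G" if "k \<in> K" for k using hom_in_carrier[OF s] that by simp
  have sm: "s (k \<otimes> l) = s k \<otimes> s l" if "k \<in> K" "l \<in> K" for k l using hom_mult[OF s] that by simp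
  define N where "N = p ^ multiplicity p (card K)"
  define W where "W = {k \<in> K. k [^] N \<in> V}"
  have Wc: "w \<in> carrier G" if "w \<in> W" for w using that Kc by (simp add: W_def)
  have WK: "W \<subseteq> K" by (auto simp: W_def)
  have W_iff: "k \<in> W \<longleftrightarrow> k \<in> K \<and> (V #> k) [^]\<^bsub>G Mod V\<^esub> N = \<one>\<^bsub>G Mod V\<^esub>" for k
  proof (cases "k \<in> K")
    case True
    then show ?thesis
      using coset_eq_one_iff[OF V nat_pow_closed[OF Kc[OF True]], of N] q.hom_nat_pow[OF Kc[OF True], of N]
      by (simp add: W_def)
  qed (simp add: W_def)
  have quot_com: "(V #> x) \<otimes>\<^bsub>G Mod V\<^esub> (V #> y) = (V #> y) \<otimes>\<^bsub>G Mod V\<^esub> (V #> x)"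
    if xy: "x \<in> carrier G" "y \<in> carrier G" for x y
  proof -
    define d where "d = x \<otimes> y \<otimes> inv x \<otimes> inv y"
    have dc: "d \<in> carrier G" using xy by (simp add: d_def)
    have "V #> d = \<one>\<^bsub>G Mod V\<^esub>" using coset_eq_one_iff[OF V dc] comV[OF xy] by (simp add: V_def d_def)
    moreover have "V #> (x \<otimes> y) = (V #> d) \<otimes>\<^bsub>G Mod V\<^esub> (V #> (y \<otimes> x))"
    proof -
      have "x \<otimes> y = d \<otimes> (y \<otimes> x)" using xy by (simp add: d_def word_simps)
      then show ?thesis using q.hom_mult[OF dc, of "y \<otimes> x"] xy by simp
    qed
    ultimately have "V #> (x \<otimes> y) = V #> (y \<otimes> x)"
      using q.H.l_one[of "V #> (y \<otimes> x)"] q.hom_closed[of "y \<otimes> x"] xy by simp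
    then show ?thesis using q.hom_mult[OF xy] q.hom_mult[OF xy(2,1)] by simp
  qed
  have Wsub: "subgroup W G"
  proof (rule subgroupI)
    show "W \<subseteq> carrier G" using Wc by blast
    have "\<one> \<in> W"
      using subgroup.one_closed[OF K] subgroup.one_closed[OF normal_imp_subgroup[OF V]] by (simp add: W_def)
    then show "W \<noteq> {}" by blast
  next
    fix x assume x: "x \<in> W"
    then have "inv x \<in> K" "inv (x [^] N) \<in> V"
      using subgroup.m_inv_closed[OF K] subgroup.m_inv_closed[OF normal_imp_subgroup[OF V]] by (auto simp: W_def)
    then show "inv x \<in> W" using nat_pow_inv[OF Wc[OF x]] by (simp add: W_def)
  next
    fix x y assume xy: "x \<in> W" "y \<in> W"
    have "(V #> (x \<otimes> y)) [^]\<^bsub>G Mod V\<^esub> N = ((V #> x) \<otimes>\<^bsub>G Mod V\<^esub> (V #> y)) [^]\<^bsub>G Mod V\<^esub> N"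
      using q.hom_mult Wc xy by simp
    also have "\<dots> = (V #> x) [^]\<^bsub>G Mod V\<^esub> N \<otimes>\<^bsub>G Mod V\<^esub> (V #> y) [^]\<^bsub>G Mod V\<^esub> N"
      by (rule q.H.pow_mult_distrib) (use quot_com Wc xy in auto)
    also have "\<dots> = \<one>\<^bsub>G Mod V\<^esub>" using xy[unfolded W_iff] q.H.l_one[OF q.H.one_closed] by argo
    finally show "x \<otimes> y \<in> W" using xy subgroup.m_closed[OF K] unfolding W_iff by blast
  qed
  have Wnorm: "k \<otimes> w \<otimes> inv k \<in> W" if k: "k \<in> K" and w: "w \<in> W" for k w
  proof -
    have "k \<otimes> w \<otimes> inv k \<in> K" using k w WK subgroup.m_closed[OF K] subgroup.m_inv_closed[OF K] by blast
    moreover have "k \<otimes> w [^] N \<otimes> inv k \<in> V" using normal.inv_op_closed2[OF V Kc[OF k]] w by (simp add: W_def)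
    ultimately show ?thesis using pow_conj[OF Kc[OF k] Wc[OF w], of N] by (simp add: W_def)
  qed
  have QW: "Q \<subseteq> W"
  proof
    fix x assume "x \<in> Q"
    then show "x \<in> W"
      using subgroup_pow_card[OF Q(1)] Q(2,3) subgroup.one_closed[OF normal_imp_subgroup[OF V]]
      by (auto simp: W_def N_def)
  qed
  define F where "F = {w \<in> W. s w = w}"
  have "F = W"
  proof (rule subgroup_eq_if_contains_sylows[OF fin Wsub])
    show "subgroup F G"
    proof (rule subgroupI)
      show "F \<subseteq> carrier G" using Wc by (auto simp: F_def)
      have "\<one> \<in> Q" using subgroup.one_closed[OF Q(1)] .
      then show "F \<noteq> {}" using Q(4) QW by (auto simp: F_def)
    next
      fix x assume "x \<in> F"
      then have x: "x \<in> W" "s x = x" "x \<in> K" "inv x \<in> K" "x \<in> carrier G"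
        using WK subgroup.m_inv_closed[OF K] Wc by (auto simp: F_def)
      have "s (inv x) \<otimes> x = s (inv x \<otimes> x)" using sm[OF x(4,3)] x(2) by simp
      also have "\<dots> = \<one>" using x(5) Q(4)[OF subgroup.one_closed[OF Q(1)]] by simp
      finally have "s (inv x) = inv x" using sc[OF x(4)] x(5) inv_equality by metis
      then show "inv x \<in> F" using subgroup.m_inv_closed[OF Wsub x(1)] by (simp add: F_def)
    next
      fix x y assume "x \<in> F" "y \<in> F"
      then show "x \<otimes> y \<in> F" using subgroup.m_closed[OF Wsub] sm WK by (auto simp: F_def subset_iff)
    qed
    show "F \<subseteq> W" by (auto simp: F_def)
    fix r :: nat assume r: "Factorial_Ring.prime r"
    obtain R where R: "subgroup R G" "R \<subseteq> W" "card R = r ^ multiplicity r (card W)"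
      using sylow_subgroup_of_subgroup[OF fin Wsub r] by blast
    show "\<exists>R. subgroup R G \<and> R \<subseteq> F \<and> card R = r ^ multiplicity r (card W)"
    proof (cases "r = p")
      case True
      have pos: "card W > 0" "card K > 0"
        using subgroup.finite_imp_card_positive[OF Wsub fin] subgroup.finite_imp_card_positive[OF K fin] by auto
      have u: "\<not> is_unit p" using p not_prime_unit by blast
      have "multiplicity p (card K) \<le> multiplicity p (card W)"
        using subgroup_card_dvd[OF Q(1) Wsub QW] Q(3) pos u by (intro multiplicity_geI) auto
      moreover have "multiplicity p (card W) \<le> multiplicity p (card K)"
        using subgroup_card_dvd[OF Wsub K WK] pos by (intro dvd_imp_multiplicity_le) auto
      ultimately show ?thesis using Q QW True by (intro exI[of _ Q]) (auto simp: F_def)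
    next
      case False
      have cop: "coprime (p ^ i) (card R)" for i
        using primes_coprime[OF p r] False R(3) by auto
      have "y \<in> F" if y: "y \<in> R" for y
      proof -
        have yW: "y \<in> W" and yK: "y \<in> K" and yc: "y \<in> carrier G" using y R(2) WK Wc by auto
        \<comment> \<open>the \<open>N\<close>-th power enters \<open>V\<close>, and a further \<open>(p\<^sup>a)\<^sup>n\<close>-th power centralizes \<open>P\<close>\<close>
        define m where "m = N * (p ^ a) ^ n"
        have mp: "m = p ^ (multiplicity p (card K) + a * n)" by (simp add: m_def N_def power_add power_mult)
        have com: "y \<otimes> x = x \<otimes> y" if x: "x \<in> P" for x
        proof (rule commute_if_coprime_power_commutes[OF yc Pc[OF x]])
          have "y [^] N \<in> series_centralizer G H n" using yW by (simp add: W_def V_def)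
          then have "(y [^] N) [^] ((p ^ a) ^ n) \<otimes> x = x \<otimes> (y [^] N) [^] ((p ^ a) ^ n)"
            by (rule series_centralizer_power_centralizes[OF ns _ P M x])
          then show "y [^] m \<otimes> x = x \<otimes> y [^] m" using yc by (simp add: nat_pow_pow m_def)
          show "y [^] card R = \<one>" using subgroup_pow_card[OF R(1) y] .
          show "coprime m (card R)" unfolding mp by (rule cop)
        qed
        have "s y = y"
          using hom_eq_if_commuting_coprime[OF K s yK subgroup_pow_card[OF R(1) y] M[OF sP[OF yK]]
            com[OF sP[OF yK]] cop] .
        then show ?thesis using yW by (simp add: F_def)
      qed
      then show ?thesis using R by blast
    qed
  qed
  then have "\<forall>w\<in>W. s w = w" by (auto simp: F_def)
  then show ?thesis using Wsub QW WK Wnorm by blast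
qed

text \<open>With \<open>W\<close> normal in \<open>K\<close> and fixed by \<open>s\<close>, applying \<open>s\<close> to \<open>w k = k w'\<close> shows that \<open>s k k\<^sup>-\<^sup>1\<close>
centralizes \<open>W\<close>. Thus \<open>s\<close> deviates from the inclusion only by \<open>R = C\<^sub>P(W)\<close>, and it is corrected modulo
ever smaller terms of the series. Every correction is made by an element of \<open>R\<close>, so \<open>s\<close> stays the identity
on \<open>W\<close> throughout.\<close>

lemma hom_conjugate_over_p_group_fixed_sylow:
  assumes fin: "finite (carrier G)" and p: "Factorial_Ring.prime (p::nat)"
    and ns: "normal_series G H n"
    and cyc: "\<And>i. i < n \<Longrightarrow> cyclic_group (G\<lparr>carrier := H (Suc i)\<rparr> Mod H i)"
    and P: "P \<lhd> G" and M: "\<And>x. x \<in> P \<Longrightarrow> x [^] (p ^ a) = \<one>"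
    and K: "subgroup K G" and s: "s \<in> hom (G\<lparr>carrier := K\<rparr>) G"
    and sP: "\<And>k. k \<in> K \<Longrightarrow> s k \<otimes> inv k \<in> P"
    and Q: "subgroup Q G" "Q \<subseteq> K" "card Q = p ^ multiplicity p (card K)" "\<And>x. x \<in> Q \<Longrightarrow> s x = x"
  shows "\<exists>b\<in>P. \<forall>k\<in>K. s k = b \<otimes> k \<otimes> inv b"
proof -
  have H: "H i \<lhd> G" if "i \<le> n" for i using that ns by (simp add: normal_series_def)
  have comH: "x \<otimes> y \<otimes> inv x \<otimes> inv y \<in> H i" if "i < n" "x \<in> H (Suc i)" "y \<in> H (Suc i)" for i x y
    using cyclic_factor_commutators(1)[OF H H cyc that(2,3)] that(1) by simp
  have comV: "g \<otimes> h \<otimes> inv g \<otimes> inv h \<in> series_centralizer G H n" if "g \<in> carrier G" "h \<in> carrier G" for g h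
  proof -
    have "(g \<otimes> h \<otimes> inv g \<otimes> inv h) \<otimes> x \<otimes> inv (g \<otimes> h \<otimes> inv g \<otimes> inv h) \<otimes> inv x \<in> H i"
      if "i < n" "x \<in> H (Suc i)" for i x
      using cyclic_factor_commutators(2)[OF H H cyc] that \<open>g \<in> carrier G\<close> \<open>h \<in> carrier G\<close> by simp
    then show ?thesis using that unfolding series_centralizer_def by auto
  qed
  obtain W where W: "subgroup W G" "Q \<subseteq> W" "W \<subseteq> K"
    and WK: "\<And>k w. k \<in> K \<Longrightarrow> w \<in> W \<Longrightarrow> k \<otimes> w \<otimes> inv k \<in> W" and sW: "\<And>w. w \<in> W \<Longrightarrow> s w = w"
    using hom_identity_on_normal_subgroup[OF fin p ns comV P M K s sP Q] by blast
  note Kc = subgroup.mem_carrier[OF K] and Pc = subgroup.mem_carrier[OF normal_imp_subgroup[OF P]]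
    and Wc = subgroup.mem_carrier[OF W(1)]
  have sc: "s k \<in> carrier G" if "k \<in> K" for k using hom_in_carrier[OF s] that by simp
  have sm: "s (k \<otimes> l) = s k \<otimes> s l" if "k \<in> K" "l \<in> K" for k l using hom_mult[OF s] that by simp
  define R where "R = {x \<in> P. \<forall>w\<in>W. x \<otimes> w = w \<otimes> x}"
  have Rc: "x \<in> carrier G" if "x \<in> R" for x using that Pc by (simp add: R_def)
  have R: "subgroup R G"
  proof (rule subgroupI)
    show "R \<subseteq> carrier G" using Rc by blast
    have "\<one> \<in> R" using subgroup.one_closed[OF normal_imp_subgroup[OF P]] Wc by (simp add: R_def)
    then show "R \<noteq> {}" by blast
  next
    fix x assume x: "x \<in> R"
    have "inv x \<otimes> w = w \<otimes> inv x" if w: "w \<in> W" for w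
    proof -
      have "x \<otimes> w = w \<otimes> x" using x w by (simp add: R_def)
      then have "inv x \<otimes> (x \<otimes> w) \<otimes> inv x = inv x \<otimes> (w \<otimes> x) \<otimes> inv x" by simp
      then show ?thesis using Rc[OF x] Wc[OF w] by (simp add: word_simps)
    qed
    then show "inv x \<in> R" using x subgroup.m_inv_closed[OF normal_imp_subgroup[OF P]] by (simp add: R_def)
  next
    fix x y assume xy: "x \<in> R" "y \<in> R"
    have "x \<otimes> y \<otimes> w = w \<otimes> (x \<otimes> y)" if w: "w \<in> W" for w
    proof -
      note cr = Rc[OF xy(1)] Rc[OF xy(2)] Wc[OF w]
      have "x \<otimes> y \<otimes> w = x \<otimes> (y \<otimes> w)" using cr by (simp add: m_assoc)
      also have "y \<otimes> w = w \<otimes> y" using xy(2) w by (simp add: R_def)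
      also have "x \<otimes> (w \<otimes> y) = (x \<otimes> w) \<otimes> y" using cr by (simp add: m_assoc)
      also have "x \<otimes> w = w \<otimes> x" using xy(1) w by (simp add: R_def)
      finally show ?thesis using cr by (simp add: m_assoc)
    qed
    then show "x \<otimes> y \<in> R" using xy subgroup.m_closed[OF normal_imp_subgroup[OF P]] by (simp add: R_def)
  qed
  have RK: "k \<otimes> x \<otimes> inv k \<in> R" if k: "k \<in> K" and x: "x \<in> R" for k x
  proof -
    have "k \<otimes> x \<otimes> inv k \<otimes> w = w \<otimes> (k \<otimes> x \<otimes> inv k)" if w: "w \<in> W" for w
    proof -
      define w' where "w' = inv k \<otimes> w \<otimes> k"
      have w': "w' \<in> W" using WK[OF subgroup.m_inv_closed[OF K k] w] Kc[OF k] by (simp add: w'_def)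
      note cr = Kc[OF k] Rc[OF x] Wc[OF w] Wc[OF w']
      have kw: "w = k \<otimes> w' \<otimes> inv k" using cr by (simp add: w'_def word_simps)
      have "k \<otimes> x \<otimes> inv k \<otimes> w = k \<otimes> (x \<otimes> w') \<otimes> inv k" unfolding kw using cr by (simp add: word_simps)
      also have "x \<otimes> w' = w' \<otimes> x" using x w' by (simp add: R_def)
      also have "k \<otimes> (w' \<otimes> x) \<otimes> inv k = w \<otimes> (k \<otimes> x \<otimes> inv k)" unfolding kw using cr by (simp add: word_simps)
      finally show ?thesis .
    qed
    then show ?thesis using normal.inv_op_closed2[OF P Kc[OF k]] x by (simp add: R_def)
  qed
  have sR: "s k \<otimes> inv k \<in> R" if k: "k \<in> K" for k
  proof -
    have "(s k \<otimes> inv k) \<otimes> w = w \<otimes> (s k \<otimes> inv k)" if w: "w \<in> W" for w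
    proof -
      define w' where "w' = inv k \<otimes> w \<otimes> k"
      have w': "w' \<in> W" using WK[OF subgroup.m_inv_closed[OF K k] w] Kc[OF k] by (simp add: w'_def)
      note cr = Kc[OF k] sc[OF k] Wc[OF w] Wc[OF w']
      have wk: "w \<otimes> k = k \<otimes> w'" using cr by (simp add: w'_def word_simps)
      have "w \<otimes> s k = s k \<otimes> w'"
        using arg_cong[OF wk, of s] sm k w w' W(3) sW by (metis subsetD)
      then have "w \<otimes> s k \<otimes> inv k = s k \<otimes> w' \<otimes> inv k" by simp
      also have "\<dots> = s k \<otimes> inv k \<otimes> w" using cr by (simp add: w'_def word_simps)
      finally show ?thesis using cr by (simp add: m_assoc)
    qed
    then show ?thesis using sP[OF k] by (simp add: R_def)
  qed
  have index: "coprime (card (rcosets\<^bsub>G\<lparr>carrier := K\<rparr>\<^esub> W)) (p ^ a)"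
  proof -
    interpret GK: group "G\<lparr>carrier := K\<rparr>" using K by (rule subgroup.subgroup_is_group) auto
    have "card (rcosets\<^bsub>G\<lparr>carrier := K\<rparr>\<^esub> W) * card W = card K"
      using GK.lagrange[OF subgroup_incl[OF W(1) K W(3)]] by (simp add: order_def)
    moreover have "p ^ multiplicity p (card K) dvd card W"
      using subgroup_card_dvd[OF Q(1) W(1,2)] Q(3) by simp
    ultimately have "p ^ Suc (multiplicity p (card K)) dvd card K"
      if "p dvd card (rcosets\<^bsub>G\<lparr>carrier := K\<rparr>\<^esub> W)"
      using mult_dvd_mono[OF that] by fastforce
    moreover have "card K \<noteq> 0" "\<not> is_unit p"
      using subgroup.finite_imp_card_positive[OF K fin] p not_prime_unit by auto
    ultimately have "\<not> p dvd card (rcosets\<^bsub>G\<lparr>carrier := K\<rparr>\<^esub> W)"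
      using multiplicity_geI[of "card K" p "Suc (multiplicity p (card K))"] by auto
    then have "coprime (p ^ a) (card (rcosets\<^bsub>G\<lparr>carrier := K\<rparr>\<^esub> W))"
      using prime_imp_coprime[OF p] by simp
    then show ?thesis by (rule coprime_commute[THEN iffD1])
  qed
  have twist: "inv b \<otimes> s k \<otimes> b \<otimes> inv k \<in> R" if b: "b \<in> R" and k: "k \<in> K" for b k
  proof -
    have "inv b \<otimes> (s k \<otimes> inv k) \<otimes> (k \<otimes> b \<otimes> inv k) \<in> R"
      using b k RK sR subgroup.m_closed[OF R] subgroup.m_inv_closed[OF R] by simp
    then show ?thesis using Rc[OF b] Kc[OF k] sc[OF k] by (simp add: word_simps)
  qed
  \<comment> \<open>descent through the series, starting from \<open>H n = carrier G\<close>, where nothing is required\<close>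
  have "\<exists>b\<in>R. \<forall>k\<in>K. inv b \<otimes> s k \<otimes> b \<otimes> inv k \<in> H (n - j)" if "j \<le> n" for j
    using that
  proof (induction j)
    case 0
    have "inv \<one> \<otimes> s k \<otimes> \<one> \<otimes> inv k \<in> H (n - 0)" if "k \<in> K" for k
      using Kc[OF that] sc[OF that] ns by (simp add: normal_series_def)
    then show ?case using subgroup.one_closed[OF R] by blast
  next
    case (Suc j)
    define i where "i = n - Suc j"
    have i: "i < n" "Suc i = n - j" using Suc.prems by (auto simp: i_def)
    obtain b where b: "b \<in> R" and bH: "\<And>k. k \<in> K \<Longrightarrow> inv b \<otimes> s k \<otimes> b \<otimes> inv k \<in> H (Suc i)"
      using Suc i by auto
    have HSi: "H (Suc i) \<lhd> G" and Hi: "H i \<lhd> G" using H i(1) by auto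
    have "\<exists>d\<in>R \<inter> H (Suc i). \<forall>k\<in>K. inv d \<otimes> (inv b \<otimes> s k \<otimes> b) \<otimes> d \<otimes> inv k \<in> H i"
    proof (rule hom_conjugate_to_inclusion_mod[OF fin K W(1,3) WK])
      show "subgroup (R \<inter> H (Suc i)) G" by (rule subgroups_Inter_pair[OF R normal_imp_subgroup[OF HSi]])
      show "k \<otimes> d \<otimes> inv k \<in> R \<inter> H (Suc i)" if "k \<in> K" "d \<in> R \<inter> H (Suc i)" for k d
        using that RK normal.inv_op_closed2[OF HSi] Kc by blast
      show "d \<otimes> w = w \<otimes> d" if "d \<in> R \<inter> H (Suc i)" "w \<in> W" for d w using that by (simp add: R_def)
      show "x \<otimes> y \<otimes> inv x \<otimes> inv y \<in> H i" if "x \<in> R \<inter> H (Suc i)" "y \<in> R \<inter> H (Suc i)" for x y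
        using that comH[OF i(1)] by blast
      show "d [^] (p ^ a) = \<one>" if "d \<in> R \<inter> H (Suc i)" for d using that M by (simp add: R_def)
      show "(\<lambda>k. inv b \<otimes> s k \<otimes> b) \<in> hom (G\<lparr>carrier := K\<rparr>) G" by (rule conj_hom_restrict[OF K s Rc[OF b]])
      show "inv b \<otimes> s k \<otimes> b \<otimes> inv k \<in> R \<inter> H (Suc i)" if "k \<in> K" for k
        using twist[OF b that] bH[OF that] by blast
      show "inv b \<otimes> s w \<otimes> b = w" if w: "w \<in> W" for w
      proof -
        have "b \<otimes> w = w \<otimes> b" using b w by (simp add: R_def)
        then show ?thesis using sW[OF w] Rc[OF b] Wc[OF w] by (simp add: m_assoc inv_mult_cancel flip: \<open>b \<otimes> w = w \<otimes> b\<close>)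
      qed
    qed (use Hi index in auto)
    then obtain d where d: "d \<in> R" "\<And>k. k \<in> K \<Longrightarrow> inv d \<otimes> (inv b \<otimes> s k \<otimes> b) \<otimes> d \<otimes> inv k \<in> H i" by blast
    have "inv (b \<otimes> d) \<otimes> s k \<otimes> (b \<otimes> d) \<otimes> inv k \<in> H i" if k: "k \<in> K" for k
      using d(2)[OF k] Rc[OF b] Rc[OF d(1)] sc[OF k] Kc[OF k] by (simp add: word_simps)
    then show ?case using subgroup.m_closed[OF R b d(1)] unfolding i_def by blast
  qed
  from this[of n] obtain b where b: "b \<in> R" and one: "\<And>k. k \<in> K \<Longrightarrow> inv b \<otimes> s k \<otimes> b \<otimes> inv k = \<one>"
    using ns by (auto simp: normal_series_def)
  have "s k = b \<otimes> k \<otimes> inv b" if k: "k \<in> K" for k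
  proof -
    note cr = Rc[OF b] sc[OF k] Kc[OF k]
    have "b \<otimes> (inv b \<otimes> s k \<otimes> b \<otimes> inv k) \<otimes> (k \<otimes> inv b) = b \<otimes> (k \<otimes> inv b)"
      using one[OF k] cr by simp
    then show ?thesis using cr by (simp add: word_simps)
  qed
  then show ?thesis using b by (auto simp: R_def)
qed

lemma hom_conjugate_over_p_group:
  assumes fin: "finite (carrier G)" and p: "Factorial_Ring.prime (p::nat)"
    and ns: "normal_series G H n"
    and cyc: "\<And>i. i < n \<Longrightarrow> cyclic_group (G\<lparr>carrier := H (Suc i)\<rparr> Mod H i)"
    and P: "P \<lhd> G" and M: "\<And>x. x \<in> P \<Longrightarrow> x [^] (p ^ a) = \<one>"
    and K: "subgroup K G" and s: "s \<in> hom (G\<lparr>carrier := K\<rparr>) G"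
    and sP: "\<And>k. k \<in> K \<Longrightarrow> s k \<otimes> inv k \<in> P"
    and Q: "subgroup Q G" "Q \<subseteq> K" "card Q = p ^ multiplicity p (card K)"
    and v: "v \<in> P" "\<And>x. x \<in> Q \<Longrightarrow> s x = v \<otimes> x \<otimes> inv v"
  shows "\<exists>b\<in>P. \<forall>k\<in>K. s k = b \<otimes> k \<otimes> inv b"
proof -
  have P': "subgroup P G" using P by (rule normal_imp_subgroup)
  note Kc = subgroup.mem_carrier[OF K] and vc = subgroup.mem_carrier[OF P' v(1)]
  have sc: "s k \<in> carrier G" if "k \<in> K" for k using hom_in_carrier[OF s] that by simp
  have "\<exists>b\<in>P. \<forall>k\<in>K. inv v \<otimes> s k \<otimes> v = b \<otimes> k \<otimes> inv b"
  proof (rule hom_conjugate_over_p_group_fixed_sylow[OF fin p ns cyc P M K conj_hom_restrict[OF K s vc] _ Q])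
    show "inv v \<otimes> s k \<otimes> v \<otimes> inv k \<in> P" if k: "k \<in> K" for k
    proof -
      have "inv v \<otimes> (s k \<otimes> inv k) \<otimes> (k \<otimes> v \<otimes> inv k) \<in> P"
        using v(1) sP[OF k] normal.inv_op_closed2[OF P Kc[OF k] v(1)] subgroup.m_closed[OF P'] subgroup.m_inv_closed[OF P'] by simp
      then show ?thesis using vc Kc[OF k] sc[OF k] by (simp add: word_simps)
    qed
    show "inv v \<otimes> s x \<otimes> v = x" if "x \<in> Q" for x
      using v(2)[OF that] vc Kc[of x] that Q(2) by (auto simp: word_simps)
  qed
  then obtain b where b: "b \<in> P" "\<And>k. k \<in> K \<Longrightarrow> inv v \<otimes> s k \<otimes> v = b \<otimes> k \<otimes> inv b" by blast
  have bc: "b \<in> carrier G" using subgroup.mem_carrier[OF P' b(1)] .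
  have "s k = (v \<otimes> b) \<otimes> k \<otimes> inv (v \<otimes> b)" if k: "k \<in> K" for k
  proof -
    have "v \<otimes> (inv v \<otimes> s k \<otimes> v) \<otimes> inv v = v \<otimes> (b \<otimes> k \<otimes> inv b) \<otimes> inv v" using b(2)[OF k] by simp
    then show ?thesis using vc bc sc[OF k] Kc[OF k] by (simp add: word_simps)
  qed
  then show ?thesis using subgroup.m_closed[OF P' v(1) b(1)] by blast
qed

end

section \<open>Assembling the primes\<close>

text \<open>Raising to the power \<open>e\<close> is the projection of \<open>N\<close> to its \<open>p\<close>-primary part; the last clause
describes its kernel as the elements of order prime to \<open>p\<close>.\<close>

definition primary_exponent :: "('a, 'b) monoid_scheme \<Rightarrow> 'a set \<Rightarrow> nat \<Rightarrow> nat \<Rightarrow> bool"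
  where "primary_exponent G N p e \<longleftrightarrow>
    (\<forall>x\<in>N. \<forall>y\<in>N. (x \<otimes>\<^bsub>G\<^esub> y) [^]\<^bsub>G\<^esub> e = x [^]\<^bsub>G\<^esub> e \<otimes>\<^bsub>G\<^esub> y [^]\<^bsub>G\<^esub> e) \<and>
    (\<forall>x\<in>N. (x [^]\<^bsub>G\<^esub> e) [^]\<^bsub>G\<^esub> (p ^ multiplicity p (card N)) = \<one>\<^bsub>G\<^esub>) \<and>
    (\<forall>x\<in>N. \<forall>k. x [^]\<^bsub>G\<^esub> (p ^ k) = \<one>\<^bsub>G\<^esub> \<longrightarrow> x [^]\<^bsub>G\<^esub> e = x) \<and>
    (\<forall>x\<in>N. x [^]\<^bsub>G\<^esub> e = \<one>\<^bsub>G\<^esub> \<longleftrightarrow> (\<exists>k. \<not> p dvd k \<and> x [^]\<^bsub>G\<^esub> k = \<one>\<^bsub>G\<^esub>))"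

lemma primary_exponentD:
  assumes "primary_exponent G N p e"
  shows "\<And>x y. x \<in> N \<Longrightarrow> y \<in> N \<Longrightarrow> (x \<otimes>\<^bsub>G\<^esub> y) [^]\<^bsub>G\<^esub> e = x [^]\<^bsub>G\<^esub> e \<otimes>\<^bsub>G\<^esub> y [^]\<^bsub>G\<^esub> e"
    and "\<And>x. x \<in> N \<Longrightarrow> (x [^]\<^bsub>G\<^esub> e) [^]\<^bsub>G\<^esub> (p ^ multiplicity p (card N)) = \<one>\<^bsub>G\<^esub>"
    and "\<And>x k. x \<in> N \<Longrightarrow> x [^]\<^bsub>G\<^esub> (p ^ k) = \<one>\<^bsub>G\<^esub> \<Longrightarrow> x [^]\<^bsub>G\<^esub> e = x"
    and "\<And>x. x \<in> N \<Longrightarrow> x [^]\<^bsub>G\<^esub> e = \<one>\<^bsub>G\<^esub> \<longleftrightarrow> (\<exists>k. \<not> p dvd k \<and> x [^]\<^bsub>G\<^esub> k = \<one>\<^bsub>G\<^esub>)"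
  using assms unfolding primary_exponent_def by blast+

context group
begin

lemma nilpotent_subgroup_primary_exponent:
  assumes fin: "finite (carrier G)" and N: "subgroup N G" and nil: "nilpotent_group (G\<lparr>carrier := N\<rparr>)"
    and p: "Factorial_Ring.prime (p::nat)"
  shows "(\<exists>e. primary_exponent G N p e) \<and>
    card {x \<in> N. x [^] (p ^ multiplicity p (card N)) = \<one>} = p ^ multiplicity p (card N)"
proof -
  interpret N: group "G\<lparr>carrier := N\<rparr>" using N by (rule subgroup.subgroup_is_group) auto
  have finN: "finite (carrier (G\<lparr>carrier := N\<rparr>))" using finite_subset[OF subgroup.subset[OF N] fin] by simp
  have pw: "x [^]\<^bsub>G\<lparr>carrier := N\<rparr>\<^esub> (k::nat) = x [^] k" for x k by (rule nat_pow_consistent[symmetric])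
  have simps: "carrier (G\<lparr>carrier := N\<rparr>) = N" "order (G\<lparr>carrier := N\<rparr>) = card N"
    "\<one>\<^bsub>G\<lparr>carrier := N\<rparr>\<^esub> = \<one>" "\<And>x y. x \<otimes>\<^bsub>G\<lparr>carrier := N\<rparr>\<^esub> y = x \<otimes> y" by (simp_all add: order_def)
  show ?thesis
  proof (rule N.nilpotent_primary_projection[OF nil finN p, unfolded pw simps])
    fix e :: nat
    assume e: "\<And>x y. x \<in> N \<Longrightarrow> y \<in> N \<Longrightarrow> (x \<otimes> y) [^] e = x [^] e \<otimes> y [^] e"
      "\<And>x. x \<in> N \<Longrightarrow> (x [^] e) [^] (p ^ multiplicity p (card N)) = \<one>"
      "\<And>x k. x \<in> N \<Longrightarrow> x [^] (p ^ k) = \<one> \<Longrightarrow> x [^] e = x"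
      "\<And>x k. x \<in> N \<Longrightarrow> x [^] k = \<one> \<Longrightarrow> \<not> p dvd k \<Longrightarrow> x [^] e = \<one>"
      "\<And>x. x \<in> N \<Longrightarrow> p dvd N.ord x \<Longrightarrow> x [^] e \<noteq> \<one>"
      "card {x \<in> N. x [^] (p ^ multiplicity p (card N)) = \<one>} = p ^ multiplicity p (card N)"
    have ek: "x [^] e = \<one> \<longleftrightarrow> (\<exists>k. \<not> p dvd k \<and> x [^] k = \<one>)" if x: "x \<in> N" for x
      using e(4)[OF x] e(5)[OF x] N.pow_ord_eq_1[of x] x unfolding pw simps by blast
    have "primary_exponent G N p e"
      unfolding primary_exponent_def using e(1-3) ek by (intro conjI ballI allI impI)
    then show ?thesis using e(6) by blast
  qed
qed

text \<open>The \<open>p\<close>-primary part is the image of the power map, hence closed under products; its description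
by an exponent makes it invariant under conjugation.\<close>

lemma primary_part_normal:
  assumes fin: "finite (carrier G)" and N: "N \<lhd> G" and nil: "nilpotent_group (G\<lparr>carrier := N\<rparr>)"
    and p: "Factorial_Ring.prime (p::nat)"
  shows "{x \<in> N. x [^] (p ^ multiplicity p (card N)) = \<one>} \<lhd> G"
proof -
  have N': "subgroup N G" using N by (rule normal_imp_subgroup)
  note Nc = subgroup.mem_carrier[OF N']
  obtain e where "primary_exponent G N p e"
      using nilpotent_subgroup_primary_exponent[OF fin N' nil p] by blast
    note e = primary_exponentD[OF this]
  define P where "P = {x \<in> N. x [^] (p ^ multiplicity p (card N)) = \<one>}"
  have "subgroup P G"
  proof (rule subgroupI)
    show "P \<subseteq> carrier G" using Nc by (auto simp: P_def)
    have "\<one> \<in> P" using subgroup.one_closed[OF N'] by (simp add: P_def)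
    then show "P \<noteq> {}" by blast
  next
    fix x assume "x \<in> P"
    then show "inv x \<in> P" using nat_pow_inv[OF Nc] subgroup.m_inv_closed[OF N'] by (simp add: P_def)
  next
    fix x y assume xy: "x \<in> P" "y \<in> P"
    then have N_xy: "x \<in> N" "y \<in> N" "x \<otimes> y \<in> N" using subgroup.m_closed[OF N'] by (auto simp: P_def)
    have "x [^] e = x" "y [^] e = y" using e(3)[OF N_xy(1)] e(3)[OF N_xy(2)] xy unfolding P_def by blast+
    then have "(x \<otimes> y) [^] e = x \<otimes> y" using e(1)[OF N_xy(1,2)] by simp
    then show "x \<otimes> y \<in> P" using e(2)[OF N_xy(3)] N_xy(3) by (simp add: P_def)
  qed
  moreover have "g \<otimes> x \<otimes> inv g \<in> P" if "g \<in> carrier G" "x \<in> P" for g x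
    using that normal.inv_op_closed2[OF N] pow_conj[OF that(1) Nc] by (simp add: P_def)
  ultimately show ?thesis unfolding normal_inv_iff P_def by blast
qed

text \<open>One prime at a time, \<open>s\<close> is conjugated so that the orders of \<open>s k k\<^sup>-\<^sup>1\<close> become prime to it. For the prime
\<open>p\<close>, the map \<open>t k = (s k k\<^sup>-\<^sup>1)\<^sup>e k\<close> is again a homomorphism, now deviating from the inclusion only by
the \<open>p\<close>-part of \<open>N\<close>, and the conjugation that trivializes \<open>t\<close> is by a \<open>p\<close>-element, which is
invisible to the projections for the other primes.\<close>

lemma hom_conjugate_over_nilpotent:
  assumes fin: "finite (carrier G)" and ns: "normal_series G H n"
    and cyc: "\<And>i. i < n \<Longrightarrow> cyclic_group (G\<lparr>carrier := H (Suc i)\<rparr> Mod H i)"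
    and N: "N \<lhd> G" and nil: "nilpotent_group (G\<lparr>carrier := N\<rparr>)"
    and K: "subgroup K G" and s: "s \<in> hom (G\<lparr>carrier := K\<rparr>) G"
    and sN: "\<And>k. k \<in> K \<Longrightarrow> s k \<otimes> inv k \<in> N"
    and loc: "\<And>p::nat. Factorial_Ring.prime p \<Longrightarrow>
      \<exists>Q. subgroup Q G \<and> Q \<subseteq> K \<and> card Q = p ^ multiplicity p (card K) \<and>
        (\<exists>v\<in>N. \<forall>x\<in>Q. s x = v \<otimes> x \<otimes> inv v)"
  shows "\<exists>b\<in>N. \<forall>k\<in>K. s k = b \<otimes> k \<otimes> inv b"
proof -
  have N': "subgroup N G" using N by (rule normal_imp_subgroup)
  note Kc = subgroup.mem_carrier[OF K] and Nc = subgroup.mem_carrier[OF N']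
    and Nm = subgroup.m_closed[OF N'] and Ni = subgroup.m_inv_closed[OF N']
    and Nconj = normal.inv_op_closed2[OF N]
  have sc: "s k \<in> carrier G" if "k \<in> K" for k using hom_in_carrier[OF s] that by simp
  have twist: "inv b \<otimes> s k \<otimes> b \<otimes> inv k \<in> N" if b: "b \<in> N" and k: "k \<in> K" for b k
  proof -
    have "inv b \<otimes> (s k \<otimes> inv k) \<otimes> (k \<otimes> b \<otimes> inv k) \<in> N"
      using Nm[OF Nm[OF Ni[OF b] sN[OF k]] Nconj[OF Kc[OF k] b]] .
    then show ?thesis using Nc[OF b] Kc[OF k] sc[OF k] by (simp add: word_simps)
  qed
  have "\<exists>b\<in>N. \<forall>k\<in>K. \<forall>q\<in>F. \<exists>j. \<not> q dvd j \<and> (inv b \<otimes> s k \<otimes> b \<otimes> inv k) [^] j = \<one>"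
    if "finite F" "\<And>q. q \<in> F \<Longrightarrow> Factorial_Ring.prime (q::nat)" for F
    using that
  proof (induction F)
    case empty
    show ?case using subgroup.one_closed[OF N'] by blast
  next
    case (insert p F)
    have p: "Factorial_Ring.prime p" using insert.prems by blast
    obtain b where b: "b \<in> N"
      and bF: "\<And>k q. k \<in> K \<Longrightarrow> q \<in> F \<Longrightarrow> \<exists>j. \<not> q dvd j \<and> (inv b \<otimes> s k \<otimes> b \<otimes> inv k) [^] j = \<one>"
      using insert.IH insert.prems by blast
    obtain e where "primary_exponent G N p e"
      using nilpotent_subgroup_primary_exponent[OF fin N' nil p] by blast
    note e = primary_exponentD[OF this]
    define P where "P = {x \<in> N. x [^] (p ^ multiplicity p (card N)) = \<one>}"
    have P: "P \<lhd> G" unfolding P_def by (rule primary_part_normal[OF fin N nil p])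
    define c where "c k = inv b \<otimes> s k \<otimes> b \<otimes> inv k" for k
    have cN: "c k \<in> N" if "k \<in> K" for k unfolding c_def using twist b that .
    have powN: "x [^] (j::nat) \<in> N" if "x \<in> N" for x j
      by (induction j) (use that N' subgroup.one_closed Nm in auto)
    have conj_e: "(k \<otimes> x \<otimes> inv k) [^] e = k \<otimes> x [^] e \<otimes> inv k" if "k \<in> K" "x \<in> N" for k x
      using pow_conj[OF Kc[OF that(1)] Nc[OF that(2)]] .
    have cm: "c (k \<otimes> l) = c k \<otimes> (k \<otimes> c l \<otimes> inv k)" if "k \<in> K" "l \<in> K" for k l
      using hom_mult[OF s, of k l] that Kc sc Nc[OF b] by (simp add: c_def word_simps)
    define t where "t k = c k [^] e \<otimes> k" for k
    have t_inv: "t k \<otimes> inv k = c k [^] e" if "k \<in> K" for k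
      using Nc[OF powN[OF cN[OF that]]] Kc[OF that] by (simp add: t_def m_assoc)
    have thom: "t \<in> hom (G\<lparr>carrier := K\<rparr>) G"
    proof (rule homI)
      fix k assume "k \<in> carrier (G\<lparr>carrier := K\<rparr>)"
      then show "t k \<in> carrier G" using Nc[OF cN] Kc by (simp add: t_def)
    next
      fix k l assume "k \<in> carrier (G\<lparr>carrier := K\<rparr>)" "l \<in> carrier (G\<lparr>carrier := K\<rparr>)"
      then have kl: "k \<in> K" "l \<in> K" by auto
      have "c (k \<otimes> l) [^] e = c k [^] e \<otimes> (k \<otimes> c l [^] e \<otimes> inv k)"
        using e(1)[OF cN[OF kl(1)] Nconj[OF Kc[OF kl(1)] cN[OF kl(2)]]] conj_e[OF kl(1) cN[OF kl(2)]] cm[OF kl]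
        by simp
      then have "t (k \<otimes> l) = t k \<otimes> t l"
        using Nc[OF cN[OF kl(1)]] Nc[OF cN[OF kl(2)]] Kc[OF kl(1)] Kc[OF kl(2)] by (simp add: t_def word_simps)
      then show "t (k \<otimes>\<^bsub>G\<lparr>carrier := K\<rparr>\<^esub> l) = t k \<otimes> t l" by simp
    qed
    obtain Q v where Q: "subgroup Q G" "Q \<subseteq> K" "card Q = p ^ multiplicity p (card K)"
      and v: "v \<in> N" "\<And>x. x \<in> Q \<Longrightarrow> s x = v \<otimes> x \<otimes> inv v"
      using loc[OF p] by blast
    define v' where "v' = inv b \<otimes> v"
    have v'N: "v' \<in> N" using Nm[OF Ni[OF b] v(1)] by (simp add: v'_def)
    have tQ: "t x = v' [^] e \<otimes> x \<otimes> inv (v' [^] e)" if x: "x \<in> Q" for x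
    proof -
      have xK: "x \<in> K" using x Q(2) by blast
      note cr = Kc[OF xK] Nc[OF v'N] Nc[OF b] Nc[OF v(1)]
      have "c x = v' \<otimes> (x \<otimes> inv v' \<otimes> inv x)" using cr by (simp add: c_def v(2)[OF x] v'_def word_simps)
      then have "c x [^] e = v' [^] e \<otimes> (x \<otimes> inv v' [^] e \<otimes> inv x)"
        using e(1)[OF v'N Nconj[OF Kc[OF xK] Ni[OF v'N]]] conj_e[OF xK Ni[OF v'N]] by simp
      then show ?thesis using cr by (simp add: t_def nat_pow_inv word_simps)
    qed
    have "\<exists>m\<in>P. \<forall>k\<in>K. t k = m \<otimes> k \<otimes> inv m"
    proof (rule hom_conjugate_over_p_group[OF fin p ns cyc P _ K thom _ Q _ tQ])
      show "x [^] (p ^ multiplicity p (card N)) = \<one>" if "x \<in> P" for x using that by (simp add: P_def)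
      show "t k \<otimes> inv k \<in> P" if "k \<in> K" for k
        using t_inv[OF that] e(2)[OF cN[OF that]] powN[OF cN[OF that]] by (simp add: P_def)
      show "v' [^] e \<in> P" using e(2)[OF v'N] powN[OF v'N] by (simp add: P_def)
    qed
    then obtain m where m: "m \<in> P" and tm: "\<And>k. k \<in> K \<Longrightarrow> t k = m \<otimes> k \<otimes> inv m" by blast
    have mN: "m \<in> N" and mp: "m [^] (p ^ multiplicity p (card N)) = \<one>" using m by (auto simp: P_def)
    have new: "inv (b \<otimes> m) \<otimes> s k \<otimes> (b \<otimes> m) \<otimes> inv k = inv m \<otimes> c k \<otimes> (k \<otimes> m \<otimes> inv k)"
      if k: "k \<in> K" for k using Nc[OF b] Nc[OF mN] Kc[OF k] sc[OF k] by (simp add: c_def word_simps)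
    have "\<exists>j. \<not> q dvd j \<and> (inv (b \<otimes> m) \<otimes> s k \<otimes> (b \<otimes> m) \<otimes> inv k) [^] j = \<one>"
      if k: "k \<in> K" and q: "q \<in> insert p F" for k q
    proof (cases "q = p")
      case True
      note cr = Nc[OF mN] Nc[OF cN[OF k]] Kc[OF k]
      have "(inv m \<otimes> c k \<otimes> (k \<otimes> m \<otimes> inv k)) [^] e = inv m [^] e \<otimes> c k [^] e \<otimes> (k \<otimes> m [^] e \<otimes> inv k)"
        using e(1)[OF Nm[OF Ni[OF mN] cN[OF k]] Nconj[OF Kc[OF k] mN]] e(1)[OF Ni[OF mN] cN[OF k]] conj_e[OF k mN] by simp
      also have "\<dots> = inv m \<otimes> (t k \<otimes> inv k) \<otimes> (k \<otimes> m \<otimes> inv k)"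
        using e(3)[OF mN mp] t_inv[OF k] cr by (simp add: nat_pow_inv)
      also have "\<dots> = \<one>" unfolding tm[OF k] using cr by (simp add: word_simps)
      finally show ?thesis
        unfolding True new[OF k] using e(4)[OF Nm[OF Nm[OF Ni[OF mN] cN[OF k]] Nconj[OF Kc[OF k] mN]]] by blast
    next
      case False
      then have qF: "q \<in> F" and qp: "Factorial_Ring.prime q" using q insert.prems by auto
      obtain e' where "primary_exponent G N q e'"
      using nilpotent_subgroup_primary_exponent[OF fin N' nil qp] by blast
    note e' = primary_exponentD[OF this]
      have "\<not> q dvd p ^ multiplicity p (card N)"
        using False p qp prime_dvd_power primes_dvd_imp_eq by blast
      then have me: "m [^] e' = \<one>" using e'(4)[OF mN] mp by blast
      have ce: "c k [^] e' = \<one>" using e'(4)[OF cN[OF k]] bF[OF k qF] by (simp add: c_def)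
      have "(inv m \<otimes> c k \<otimes> (k \<otimes> m \<otimes> inv k)) [^] e' = inv m [^] e' \<otimes> c k [^] e' \<otimes> (k \<otimes> m [^] e' \<otimes> inv k)"
        using e'(1)[OF Nm[OF Ni[OF mN] cN[OF k]] Nconj[OF Kc[OF k] mN]] e'(1)[OF Ni[OF mN] cN[OF k]]
          pow_conj[OF Kc[OF k] Nc[OF mN]] by simp
      also have "\<dots> = \<one>" using me ce Nc[OF mN] Kc[OF k] by (simp add: nat_pow_inv)
      finally show ?thesis
        unfolding new[OF k] using e'(4)[OF Nm[OF Nm[OF Ni[OF mN] cN[OF k]] Nconj[OF Kc[OF k] mN]]] by blast
    qed
    then show ?case using Nm[OF b mN] by blast
  qed
  from this[of "prime_factors (card N)"] obtain b where b: "b \<in> N"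
    and bq: "\<And>k q. k \<in> K \<Longrightarrow> q \<in> prime_factors (card N) \<Longrightarrow>
      \<exists>j. \<not> q dvd j \<and> (inv b \<otimes> s k \<otimes> b \<otimes> inv k) [^] j = \<one>"
    by (auto simp: in_prime_factors_iff)
  have "s k = b \<otimes> k \<otimes> inv b" if k: "k \<in> K" for k
  proof -
    define c where "c = inv b \<otimes> s k \<otimes> b \<otimes> inv k"
    note cr = Nc[OF b] Kc[OF k] sc[OF k]
    have cN: "c \<in> N" unfolding c_def by (rule twist[OF b k])
    have cc: "c \<in> carrier G" using Nc[OF cN] .
    have od: "ord c dvd card N" using subgroup_pow_card[OF N' cN] cc pow_eq_id by blast
    have "ord c = 1"
    proof (rule ccontr)
      assume "ord c \<noteq> 1"
      then obtain q where q: "Factorial_Ring.prime q" "q dvd ord c" using prime_factor_nat by blast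
      have "card N \<noteq> 0" using subgroup.finite_imp_card_positive[OF N' fin] by simp
      then have "q \<in> prime_factors (card N)" using q od by (auto simp: in_prime_factors_iff intro: dvd_trans)
      then obtain j where "\<not> q dvd j" "c [^] j = \<one>" using bq[OF k] unfolding c_def by blast
      then show False using q(2) pow_eq_id[OF cc, of j] dvd_trans by blast
    qed
    then have "c = \<one>" using ord_eq_1[OF cc] by simp
    then have "b \<otimes> c \<otimes> (k \<otimes> inv b) = b \<otimes> k \<otimes> inv b" using cr by (simp add: m_assoc)
    then show ?thesis using cr by (simp add: c_def word_simps)
  qed
  then show ?thesis using b by blast
qed

section \<open>From complements to homomorphisms\<close>

lemma conj_subgroup:
  assumes A: "subgroup A G" and g: "g \<in> carrier G"
  shows "subgroup ((\<lambda>x. g \<otimes> x \<otimes> inv g) ` A) G" and "card ((\<lambda>x. g \<otimes> x \<otimes> inv g) ` A) = card A"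
proof -
  have "(\<lambda>x. g \<otimes> x \<otimes> inv g) \<in> hom G G" by (rule homI) (use g in \<open>simp_all add: word_simps\<close>)
  then interpret c: group_hom G G "\<lambda>x. g \<otimes> x \<otimes> inv g"
    by (simp add: group_hom_def group_hom_axioms_def)
  show "subgroup ((\<lambda>x. g \<otimes> x \<otimes> inv g) ` A) G" by (rule c.subgroup_img_is_subgroup[OF A])
  have "inj_on (\<lambda>x. g \<otimes> x \<otimes> inv g) A"
  proof (rule inj_onI)
    fix x y assume xy: "x \<in> A" "y \<in> A" "g \<otimes> x \<otimes> inv g = g \<otimes> y \<otimes> inv g"
    then have "inv g \<otimes> (g \<otimes> x \<otimes> inv g) \<otimes> g = inv g \<otimes> (g \<otimes> y \<otimes> inv g) \<otimes> g" by simp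
    then show "x = y"
      using subgroup.mem_carrier[OF A xy(1)] subgroup.mem_carrier[OF A xy(2)] g by (simp add: word_simps)
  qed
  then show "card ((\<lambda>x. g \<otimes> x \<otimes> inv g) ` A) = card A" by (rule card_image)
qed

lemma conj_coset_eq_image:
  "(g <# A) #> inv g = (\<lambda>x. g \<otimes> x \<otimes> inv g) ` A"
  by (auto simp: l_coset_def r_coset_def)

lemma complement_card:
  assumes "N \<lhd> G" "complement G N K"
  shows "card (carrier G) = card N * card K"
  using assms card_set_mult[of N K] normal_imp_subgroup by (auto simp: complement_def)

text \<open>Both complements are transversals of \<open>N\<close>; \<open>s\<close> sends \<open>k\<close> to the element of \<open>L\<close> in its coset, and
the last property says that this element is unique.\<close>

lemma complement_hom:
  assumes N: "N \<lhd> G" and K: "complement G N K" and L: "complement G N L"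
  obtains s where "s \<in> hom (G\<lparr>carrier := K\<rparr>) G" "\<And>k. k \<in> K \<Longrightarrow> s k \<in> L"
    "\<And>k. k \<in> K \<Longrightarrow> s k \<otimes> inv k \<in> N"
    "\<And>k l. k \<in> K \<Longrightarrow> l \<in> L \<Longrightarrow> l \<otimes> inv k \<in> N \<Longrightarrow> s k = l"
proof -
  have N': "subgroup N G" using N by (rule normal_imp_subgroup)
  have K': "subgroup K G" and L': "subgroup L G" and NL: "carrier G = N <#> L" "N \<inter> L = {\<one>}"
    using K L by (auto simp: complement_def)
  note Nc = subgroup.mem_carrier[OF N'] and Kc = subgroup.mem_carrier[OF K'] and Lc = subgroup.mem_carrier[OF L']
  have ex: "\<exists>l. l \<in> L \<and> l \<otimes> inv k \<in> N" if k: "k \<in> K" for k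
  proof -
    obtain n l where nl: "n \<in> N" "l \<in> L" "k = n \<otimes> l" using Kc[OF k] NL(1) unfolding set_mult_def by blast
    have "l \<otimes> inv k = inv n" using Nc[OF nl(1)] Lc[OF nl(2)] by (simp add: nl(3) word_simps)
    then show ?thesis using nl subgroup.m_inv_closed[OF N'] by auto
  qed
  have uniq: "l = l'" if "k \<in> K" "l \<in> L" "l' \<in> L" "l \<otimes> inv k \<in> N" "l' \<otimes> inv k \<in> N" for k l l'
  proof -
    note cr = Kc[OF that(1)] Lc[OF that(2)] Lc[OF that(3)]
    have "(l \<otimes> inv k) \<otimes> inv (l' \<otimes> inv k) \<in> N"
      using subgroup.m_closed[OF N' that(4) subgroup.m_inv_closed[OF N' that(5)]] .
    then have "l \<otimes> inv l' \<in> N" using cr by (simp add: word_simps)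
    moreover have "l \<otimes> inv l' \<in> L" using subgroup.m_closed[OF L' that(2) subgroup.m_inv_closed[OF L' that(3)]] .
    ultimately have "l \<otimes> inv l' = \<one>" using NL(2) by blast
    then show ?thesis using cr inv_equality inv_inv by (metis inv_closed)
  qed
  define s where "s k = (SOME l. l \<in> L \<and> l \<otimes> inv k \<in> N)" for k
  have s: "s k \<in> L \<and> s k \<otimes> inv k \<in> N" if "k \<in> K" for k
    unfolding s_def by (rule someI_ex[OF ex[OF that]])
  have u: "s k = l" if "k \<in> K" "l \<in> L" "l \<otimes> inv k \<in> N" for k l
    using uniq[OF that(1) _ that(2) _ that(3)] s[OF that(1)] by blast
  have "s \<in> hom (G\<lparr>carrier := K\<rparr>) G"
  proof (rule homI)
    fix k assume "k \<in> carrier (G\<lparr>carrier := K\<rparr>)"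
    then show "s k \<in> carrier G" using s Lc by simp
  next
    fix k l assume "k \<in> carrier (G\<lparr>carrier := K\<rparr>)" "l \<in> carrier (G\<lparr>carrier := K\<rparr>)"
    then have kl: "k \<in> K" "l \<in> K" by auto
    note cr = Kc[OF kl(1)] Kc[OF kl(2)] Lc[OF conjunct1[OF s[OF kl(1)]]] Lc[OF conjunct1[OF s[OF kl(2)]]]
    have "(s k \<otimes> inv k) \<otimes> (k \<otimes> (s l \<otimes> inv l) \<otimes> inv k) \<in> N"
      using subgroup.m_closed[OF N'] normal.inv_op_closed2[OF N cr(1)] s kl by blast
    then have "(s k \<otimes> s l) \<otimes> inv (k \<otimes> l) \<in> N" using cr by (simp add: word_simps)
    then have "s (k \<otimes> l) = s k \<otimes> s l"
      using u[OF subgroup.m_closed[OF K' kl]] subgroup.m_closed[OF L'] s kl by blast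
    then show "s (k \<otimes>\<^bsub>G\<lparr>carrier := K\<rparr>\<^esub> l) = s k \<otimes> s l" by simp
  qed
  then show ?thesis using that s u by blast
qed

text \<open>A Sylow subgroup of \<open>K\<close> can be conjugated into \<open>S\<close>, and \<open>S\<close> contains the whole normal \<open>p\<close>-part \<open>P\<close> of \<open>N\<close>.
Their product already has order \<open>|N|\<^sub>p |K|\<^sub>p = |S|\<close>, so it is all of \<open>S\<close>.\<close>

lemma sylow_of_complement:
  assumes fin: "finite (carrier G)" and p: "Factorial_Ring.prime (p::nat)"
    and N: "N \<lhd> G" and nil: "nilpotent_group (G\<lparr>carrier := N\<rparr>)"
    and S: "sylow_subgroup G p S" and K: "complement G N K"
  shows "\<exists>Q g. subgroup Q G \<and> Q \<subseteq> K \<and> card Q = p ^ multiplicity p (card K) \<and> g \<in> carrier G \<and>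
    complement (G\<lparr>carrier := S\<rparr>) (S \<inter> N) ((\<lambda>x. g \<otimes> x \<otimes> inv g) ` Q)"
proof -
  have N': "subgroup N G" using N by (rule normal_imp_subgroup)
  have K': "subgroup K G" and NK: "N \<inter> K = {\<one>}" using K by (auto simp: complement_def)
  have S': "subgroup S G" "card S = p ^ multiplicity p (order G)" using S by (auto simp: sylow_subgroup_def)
  have finS: "finite S" using finite_subset[OF subgroup.subset[OF S'(1)] fin] .
  note Nc = subgroup.mem_carrier[OF N'] and Kc = subgroup.mem_carrier[OF K']
  define P where "P = {x \<in> N. x [^] (p ^ multiplicity p (card N)) = \<one>}"
  have P: "P \<lhd> G" unfolding P_def by (rule primary_part_normal[OF fin N nil p])
  have cardP: "card P = p ^ multiplicity p (card N)"
    using nilpotent_subgroup_primary_exponent[OF fin N' nil p] by (simp add: P_def)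
  have P': "subgroup P G" using P by (rule normal_imp_subgroup)
  obtain h where h: "h \<in> carrier G" "\<And>x. x \<in> P \<Longrightarrow> h \<otimes> x \<otimes> inv h \<in> S"
    using p_subgroup_conj_into[OF fin p S P' cardP] by blast
  have PS: "P \<subseteq> S"
  proof
    fix x assume x: "x \<in> P"
    have "h \<otimes> (inv h \<otimes> x \<otimes> h) \<otimes> inv h \<in> S" using h(2)[OF normal.inv_op_closed1[OF P h(1) x]] .
    then show "x \<in> S" using h(1) subgroup.mem_carrier[OF P' x] by (simp add: word_simps)
  qed
  obtain Q where Q: "subgroup Q G" "Q \<subseteq> K" "card Q = p ^ multiplicity p (card K)"
    using sylow_subgroup_of_subgroup[OF fin K' p] by blast
  obtain g where g: "g \<in> carrier G" "\<And>x. x \<in> Q \<Longrightarrow> g \<otimes> x \<otimes> inv g \<in> S"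
    using p_subgroup_conj_into[OF fin p S Q(1,3)] by blast
  define R where "R = (\<lambda>x. g \<otimes> x \<otimes> inv g) ` Q"
  have R: "subgroup R G" "card R = p ^ multiplicity p (card K)"
    using conj_subgroup[OF Q(1) g(1)] Q(3) by (auto simp: R_def)
  have RS: "R \<subseteq> S" using g(2) by (auto simp: R_def)
  have NR: "N \<inter> R = {\<one>}"
  proof -
    have "x = \<one>" if xN: "x \<in> N" and "x \<in> R" for x
    proof -
      obtain y where y: "y \<in> Q" "x = g \<otimes> y \<otimes> inv g" using \<open>x \<in> R\<close> by (auto simp: R_def)
      have yK: "y \<in> K" using y(1) Q(2) by blast
      have "inv g \<otimes> x \<otimes> g = y" using g(1) Kc[OF yK] by (simp add: y(2) word_simps)
      then have "y \<in> N" using normal.inv_op_closed1[OF N g(1) xN] by simp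
      then have "y = \<one>" using yK NK by blast
      then show ?thesis using y(2) g(1) by simp
    qed
    then show ?thesis using subgroup.one_closed[OF N'] subgroup.one_closed[OF R(1)] by blast
  qed
  have "P \<inter> R = {\<one>}"
    using NR subgroup.one_closed[OF P'] subgroup.one_closed[OF R(1)] unfolding P_def by blast
  then have cPR: "card (P <#> R) = card P * card R" by (rule card_set_mult[OF P' R(1)])
  have "card P * card R = card S"
  proof -
    have pos: "card N \<noteq> 0" "card K \<noteq> 0"
      using subgroup.finite_imp_card_positive[OF N' fin] subgroup.finite_imp_card_positive[OF K' fin] by auto
    have "multiplicity p (order G) = multiplicity p (card N) + multiplicity p (card K)"
      using complement_card[OF N K] pos p by (simp add: order_def prime_elem_multiplicity_mult_distrib)
    then show ?thesis using cardP R(2) S'(2) by (simp add: power_add)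
  qed
  moreover have PRS: "P <#> R \<subseteq> S" using PS RS subgroup.m_closed[OF S'(1)] unfolding set_mult_def by blast
  ultimately have "P <#> R = S" using card_subset_eq[OF finS PRS] cPR by simp
  then have "S \<subseteq> (S \<inter> N) <#> R" using PS unfolding set_mult_def P_def by blast
  moreover have "(S \<inter> N) <#> R \<subseteq> S" using RS subgroup.m_closed[OF S'(1)] unfolding set_mult_def by blast
  moreover have "(S \<inter> N) \<inter> R = {\<one>}" using NR RS by blast
  ultimately have "complement (G\<lparr>carrier := S\<rparr>) (S \<inter> N) R"
    using subgroup_incl[OF R(1) S'(1) RS] by (auto simp: complement_def)
  then show ?thesis using Q g(1) unfolding R_def by blast
qed

text \<open>The hypothesis conjugates a Sylow subgroup of \<open>K\<close> into \<open>L\<close> by some \<open>a \<in> G\<close>. Writing \<open>a = v k\<close> with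
\<open>v \<in> N\<close> and \<open>k \<in> K\<close>, the factor \<open>k\<close> only replaces the Sylow subgroup of \<open>K\<close> by another one.\<close>

lemma sylow_conjugate_of_complements:
  assumes fin: "finite (carrier G)" and p: "Factorial_Ring.prime (p::nat)"
    and N: "N \<lhd> G" and nil: "nilpotent_group (G\<lparr>carrier := N\<rparr>)"
    and S: "sylow_subgroup G p S"
    and conj: "\<And>A B. complement (G\<lparr>carrier := S\<rparr>) (S \<inter> N) A \<Longrightarrow>
      complement (G\<lparr>carrier := S\<rparr>) (S \<inter> N) B \<Longrightarrow> conjugate_in G A B"
    and K: "complement G N K" and L: "complement G N L"
  shows "\<exists>Q. subgroup Q G \<and> Q \<subseteq> K \<and> card Q = p ^ multiplicity p (card K) \<and>
    (\<exists>v\<in>N. \<forall>x\<in>Q. v \<otimes> x \<otimes> inv v \<in> L)"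
proof -
  have N': "subgroup N G" using N by (rule normal_imp_subgroup)
  have K': "subgroup K G" and L': "subgroup L G" and NK: "carrier G = N <#> K"
    using K L by (auto simp: complement_def)
  note Nc = subgroup.mem_carrier[OF N'] and Kc = subgroup.mem_carrier[OF K'] and Lc = subgroup.mem_carrier[OF L']
  obtain A g where A: "subgroup A G" "A \<subseteq> K" "card A = p ^ multiplicity p (card K)" and g: "g \<in> carrier G"
    and cA: "complement (G\<lparr>carrier := S\<rparr>) (S \<inter> N) ((\<lambda>x. g \<otimes> x \<otimes> inv g) ` A)"
    using sylow_of_complement[OF fin p N nil S K] by blast
  obtain B h where B: "B \<subseteq> L" and h: "h \<in> carrier G"
    and cB: "complement (G\<lparr>carrier := S\<rparr>) (S \<inter> N) ((\<lambda>x. h \<otimes> x \<otimes> inv h) ` B)"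
    using sylow_of_complement[OF fin p N nil S L] by blast
  obtain t where t: "t \<in> carrier G" and tAB: "(\<lambda>x. h \<otimes> x \<otimes> inv h) ` B =
      (\<lambda>x. t \<otimes> x \<otimes> inv t) ` ((\<lambda>x. g \<otimes> x \<otimes> inv g) ` A)"
    using conj[OF cA cB] unfolding conjugate_in_def conj_coset_eq_image by blast
  define a where "a = inv h \<otimes> t \<otimes> g"
  have ac: "a \<in> carrier G" using g h t by (simp add: a_def)
  have aL: "a \<otimes> x \<otimes> inv a \<in> L" if x: "x \<in> A" for x
  proof -
    have xc: "x \<in> carrier G" using x A(2) Kc by blast
    have "t \<otimes> (g \<otimes> x \<otimes> inv g) \<otimes> inv t \<in> (\<lambda>x. h \<otimes> x \<otimes> inv h) ` B" unfolding tAB using x by blast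
    then obtain y where y: "y \<in> B" "t \<otimes> (g \<otimes> x \<otimes> inv g) \<otimes> inv t = h \<otimes> y \<otimes> inv h" by blast
    have yc: "y \<in> carrier G" using y(1) B Lc by blast
    have "a \<otimes> x \<otimes> inv a = inv h \<otimes> (t \<otimes> (g \<otimes> x \<otimes> inv g) \<otimes> inv t) \<otimes> h"
      using g h t xc by (simp add: a_def word_simps)
    also have "\<dots> = y" unfolding y(2) using h yc by (simp add: word_simps)
    finally show ?thesis using y(1) B by blast
  qed
  obtain v k where v: "v \<in> N" and k: "k \<in> K" and a: "a = v \<otimes> k" using ac NK unfolding set_mult_def by blast
  define Q where "Q = (\<lambda>x. k \<otimes> x \<otimes> inv k) ` A"
  have Q: "subgroup Q G" "card Q = p ^ multiplicity p (card K)"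
    using conj_subgroup[OF A(1) Kc[OF k]] A(3) by (auto simp: Q_def)
  have "Q \<subseteq> K" using A(2) k subgroup.m_closed[OF K'] subgroup.m_inv_closed[OF K'] by (auto simp: Q_def)
  moreover have "v \<otimes> x \<otimes> inv v \<in> L" if xQ: "x \<in> Q" for x
  proof -
    obtain y where y: "y \<in> A" "x = k \<otimes> y \<otimes> inv k" using xQ by (auto simp: Q_def)
    have "y \<in> carrier G" using y(1) A(2) Kc by blast
    then have "v \<otimes> x \<otimes> inv v = a \<otimes> y \<otimes> inv a" using Nc[OF v] Kc[OF k] by (simp add: y(2) a word_simps)
    then show ?thesis using aL[OF y(1)] by simp
  qed
  ultimately show ?thesis using Q v by blast
qed

end

theorem corollary2:
  fixes G :: "('a, 'b) monoid_scheme" and N :: "'a set"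
  assumes "group G"
    and "finite (carrier G)"
    and "supersoluble G"
    and "N \<lhd> G"
    and "nilpotent_group (G\<lparr>carrier := N\<rparr>)"
    and "\<exists>K. complement G N K"
    and "\<And>p::nat. Factorial_Ring.prime p \<Longrightarrow>
      \<exists>S. sylow_subgroup G p S \<and>
        (\<forall>K L. complement (G\<lparr>carrier := S\<rparr>) (S \<inter> N) K \<longrightarrow>
               complement (G\<lparr>carrier := S\<rparr>) (S \<inter> N) L \<longrightarrow>
               conjugate_in G K L)"
  shows "\<forall>K L. complement G N K \<longrightarrow> complement G N L \<longrightarrow> conjugate_in G K L"
proof (intro allI impI)
  fix K L assume K: "complement G N K" and L: "complement G N L"
  interpret group G by fact
  note fin = assms(2) and N = assms(4) and nil = assms(5)
  have N': "subgroup N G" using N by (rule normal_imp_subgroup)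
  have K': "subgroup K G" and L': "subgroup L G" using K L by (auto simp: complement_def)
  obtain H n where ns: "normal_series G H n"
    and cyc: "\<And>i. i < n \<Longrightarrow> cyclic_group (G\<lparr>carrier := H (Suc i)\<rparr> Mod H i)"
    using assms(3) unfolding supersoluble_def by blast
  obtain s where s: "s \<in> hom (G\<lparr>carrier := K\<rparr>) G" and sL: "\<And>k. k \<in> K \<Longrightarrow> s k \<in> L"
    and sN: "\<And>k. k \<in> K \<Longrightarrow> s k \<otimes>\<^bsub>G\<^esub> inv\<^bsub>G\<^esub> k \<in> N"
    and uniq: "\<And>k l. k \<in> K \<Longrightarrow> l \<in> L \<Longrightarrow> l \<otimes>\<^bsub>G\<^esub> inv\<^bsub>G\<^esub> k \<in> N \<Longrightarrow> s k = l"
    using complement_hom[OF N K L] by blast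
  have "\<exists>b\<in>N. \<forall>k\<in>K. s k = b \<otimes>\<^bsub>G\<^esub> k \<otimes>\<^bsub>G\<^esub> inv\<^bsub>G\<^esub> b"
  proof (rule hom_conjugate_over_nilpotent[OF fin ns cyc N nil K' s sN])
    fix p :: nat assume p: "Factorial_Ring.prime p"
    obtain S where S: "sylow_subgroup G p S"
      "\<And>A B. complement (G\<lparr>carrier := S\<rparr>) (S \<inter> N) A \<Longrightarrow>
        complement (G\<lparr>carrier := S\<rparr>) (S \<inter> N) B \<Longrightarrow> conjugate_in G A B"
      using assms(7)[OF p] by blast
    obtain Q v where Q: "subgroup Q G" "Q \<subseteq> K" "card Q = p ^ multiplicity p (card K)"
      and v: "v \<in> N" "\<And>x. x \<in> Q \<Longrightarrow> v \<otimes>\<^bsub>G\<^esub> x \<otimes>\<^bsub>G\<^esub> inv\<^bsub>G\<^esub> v \<in> L"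
      using sylow_conjugate_of_complements[OF fin p N nil S K L] by blast
    have "s x = v \<otimes>\<^bsub>G\<^esub> x \<otimes>\<^bsub>G\<^esub> inv\<^bsub>G\<^esub> v" if x: "x \<in> Q" for x
    proof (rule uniq)
      show "x \<in> K" using x Q(2) by blast
      then have xc: "x \<in> carrier G" using subgroup.mem_carrier[OF K'] by blast
      have "v \<otimes>\<^bsub>G\<^esub> (x \<otimes>\<^bsub>G\<^esub> inv\<^bsub>G\<^esub> v \<otimes>\<^bsub>G\<^esub> inv\<^bsub>G\<^esub> x) \<in> N"
        using subgroup.m_closed[OF N' v(1) normal.inv_op_closed2[OF N xc subgroup.m_inv_closed[OF N' v(1)]]] .
      then show "v \<otimes>\<^bsub>G\<^esub> x \<otimes>\<^bsub>G\<^esub> inv\<^bsub>G\<^esub> v \<otimes>\<^bsub>G\<^esub> inv\<^bsub>G\<^esub> x \<in> N"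
        using xc subgroup.mem_carrier[OF N' v(1)] by (simp add: m_assoc)
    qed (rule v(2)[OF x])
    then show "\<exists>Q. subgroup Q G \<and> Q \<subseteq> K \<and> card Q = p ^ multiplicity p (card K) \<and>
        (\<exists>v\<in>N. \<forall>x\<in>Q. s x = v \<otimes>\<^bsub>G\<^esub> x \<otimes>\<^bsub>G\<^esub> inv\<^bsub>G\<^esub> v)"
      using Q v(1) by blast
  qed
  then obtain b where b: "b \<in> N" "\<And>k. k \<in> K \<Longrightarrow> s k = b \<otimes>\<^bsub>G\<^esub> k \<otimes>\<^bsub>G\<^esub> inv\<^bsub>G\<^esub> b" by blast
  have bc: "b \<in> carrier G" using subgroup.mem_carrier[OF N' b(1)] .
  have sub: "(\<lambda>x. b \<otimes>\<^bsub>G\<^esub> x \<otimes>\<^bsub>G\<^esub> inv\<^bsub>G\<^esub> b) ` K \<subseteq> L"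
  proof (rule image_subsetI)
    fix x assume x: "x \<in> K"
    show "b \<otimes>\<^bsub>G\<^esub> x \<otimes>\<^bsub>G\<^esub> inv\<^bsub>G\<^esub> b \<in> L" using sL[OF x] unfolding b(2)[OF x] .
  qed
  have "card N * card K = card N * card L"
    using complement_card[OF N K] complement_card[OF N L] by (rule trans[OF sym])
  then have "card K = card L"
    using nat_mult_eq_cancel1[OF subgroup.finite_imp_card_positive[OF N' fin]] by blast
  then have "(\<lambda>x. b \<otimes>\<^bsub>G\<^esub> x \<otimes>\<^bsub>G\<^esub> inv\<^bsub>G\<^esub> b) ` K = L"
    using card_subset_eq[OF finite_subset[OF subgroup.subset[OF L'] fin] sub] conj_subgroup(2)[OF K' bc] by simp
  then show "conjugate_in G K L" using bc unfolding conjugate_in_def conj_coset_eq_image by blast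
qed

end
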